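(* Let $P$ be a weighted oriented path. Then $\beta_{r,d}(R/I(P_{\mathrm{sink}}))=\beta_{r,d}(R/I(P_{\mathrm{iron}}))$ for all indices $r,d$. In particular, $\beta_r(R/I(P))=\beta_r(R/I(P_{\mathrm{sink}}))=\beta_r(R/I(P_{\mathrm{iron}}))$ for every index $r$.
   Context: A weighted oriented graph is a triple $\mathcal D=(V,E,\mathbf w)$ with $V$ a finite vertex set, $E$ a set of directed edges whose underlying undirected graph is simple, and $\mathbf w:V\to\mathbb N^+$. Over a field $\Bbbk$, with $R=\Bbbk[V]$ (standard grading), its edge ideal is $I(\mathcal D)=(xy^{\mathbf w(y)}\mid(x,y)\in E)$, where $(x,y)$ is the edge oriented from $x$ to $y$. $\beta_{r,d}$ and $\beta_r$ denote graded and total Betti numbers over $R$. A weighted oriented path $P$ has underlying graph a path on vertices $x_1,\dots,x_{n+1}$ with edges between $x_i$ and $x_{i+1}$ for $1\le i\le n$, with arbitrary orientations. A vertex is a sink if every edge incident to it is oriented towards it. $P_{\mathrm{sink}}$ has the same oriented edges as $P$ and weights $\mathbf w_{\mathrm{sink}}(x_i)=1$ if $x_i$ is a sink, and $\mathbf w_{\mathrm{sink}}(x_i)=\mathbf w(x_i)$ otherwise. $P_{\mathrm{iron}}$ is obtained from $P_{\mathrm{sink}}$ by reversing each edge of the form $(x_i,x_{i-1})$, so that its edges are $(x_i,x_{i+1})$ for all $1\le i\le n$, with weights $\mathbf w_{\mathrm{iron}}(x_i)=\mathbf w_{\mathrm{sink}}(x_{i-1})$ if $(x_i,x_{i-1})\in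 E(P_{\mathrm{sink}})$, and $\mathbf w_{\mathrm{iron}}(x_i)=\mathbf w_{\mathrm{sink}}(x_i)$ otherwise. *)

theory Defs
  imports "Jordan_Normal_Form.Matrix_Kernel" "HOL-Library.Poly_Mapping"
begin

section \<open>Polynomial rings and graded Betti numbers\<close>

text \<open>The polynomial ring \<open>k[V]\<close>, where \<open>V\<close> is the set of all elements of the type \<open>'v\<close>: a
  polynomial maps each monomial, given by its exponent vector, to its coefficient.\<close>

type_synonym ('v, 'k) mpoly = "('v \<Rightarrow>\<^sub>0 nat) \<Rightarrow>\<^sub>0 'k"

definition var :: "'v \<Rightarrow> ('v, 'k::zero_neq_one) mpoly" where
  "var v = Poly_Mapping.single (Poly_Mapping.single v 1) 1"

definition monom_degree :: "('v \<Rightarrow>\<^sub>0 nat) \<Rightarrow> nat" where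
  "monom_degree m = (\<Sum>v\<in>Poly_Mapping.keys m. Poly_Mapping.lookup m v)"

text \<open>The zero polynomial is homogeneous of every degree, and it is the only one of negative
  degree.\<close>

definition homogeneous :: "int \<Rightarrow> ('v, 'k::zero) mpoly \<Rightarrow> bool" where
  "homogeneous e p \<longleftrightarrow> (\<forall>m\<in>Poly_Mapping.keys p. int (monom_degree m) = e)"

text \<open>The graded maximal ideal, generated by all the variables.\<close>

definition irrelevant_ideal :: "('v, 'k::comm_ring_1) mpoly set" where
  "irrelevant_ideal = Modules.module.span (*) (range var)"

text \<open>
  Graded free resolutions \<open>\<dots> \<rightarrow> F 1 \<rightarrow> F 0 \<rightarrow> R/I \<rightarrow> 0\<close> of \<open>R/I\<close>, where \<open>R = k[V]\<close>. The module \<open>F i\<close> is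
  the direct sum of the \<open>R(- s i j)\<close> for \<open>j < b i\<close>, i.e. its elements are the vectors of length
  \<open>b i\<close> and its \<open>j\<close>-th basis vector has degree \<open>s i j\<close>. The matrix \<open>d i\<close> describes the map
  \<open>F (i + 1) \<rightarrow> F i\<close>; that this map preserves degrees means that the entry in row \<open>k\<close> and column \<open>j\<close>
  is homogeneous of degree \<open>s (i + 1) j - s i k\<close>. The augmentation \<open>F 0 \<rightarrow> R/I\<close> sends the \<open>j\<close>-th
  basis vector to the residue class of the entry \<open>a $ j\<close>.
\<close>

locale graded_free_resolution =
  fixes I :: "('v, 'k::field) mpoly set"
    and b :: "nat \<Rightarrow> nat"
    and s :: "nat \<Rightarrow> nat \<Rightarrow> int"
    and a :: "('v, 'k) mpoly vec"
    and d :: "nat \<Rightarrow> ('v, 'k) mpoly mat"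
  assumes aug_carrier: "a \<in> carrier_vec (b 0)"
    and diff_carrier: "d i \<in> carrier_mat (b i) (b (Suc i))"
    and aug_homogeneous: "j < b 0 \<Longrightarrow> homogeneous (s 0 j) (a $ j)"
    and diff_homogeneous:
      "k < b i \<Longrightarrow> j < b (Suc i) \<Longrightarrow> homogeneous (s (Suc i) j - s i k) (d i $$ (k, j))"
    and aug_surj: "\<exists>c\<in>carrier_vec (b 0). f - a \<bullet> c \<in> I"
    and exact_0: "{d 0 *\<^sub>v c | c. c \<in> carrier_vec (b 1)} = {c \<in> carrier_vec (b 0). a \<bullet> c \<in> I}"
    and exact_Suc: "{d (Suc i) *\<^sub>v c | c. c \<in> carrier_vec (b (Suc (Suc i)))} = mat_kernel (d i)"

locale minimal_graded_free_resolution = graded_free_resolution +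
  assumes minimal: "k < b i \<Longrightarrow> j < b (Suc i) \<Longrightarrow> d i $$ (k, j) \<in> irrelevant_ideal"

text \<open>
  For a homogeneous ideal \<open>I\<close> in finitely many variables, \<open>R/I\<close> has a minimal graded free resolution
  and its graded ranks do not depend on the choice of the resolution. The following are the
  Betti numbers of \<open>R/I\<close>, not of \<open>I\<close>.
\<close>

definition graded_betti_quot :: "('v, 'k::field) mpoly set \<Rightarrow> nat \<Rightarrow> int \<Rightarrow> nat" where
  "graded_betti_quot I r e =
    (THE n. \<exists>b s a d. minimal_graded_free_resolution I b s a d \<and> n = card {j. j < b r \<and> s r j = e})"

definition betti_quot :: "('v, 'k::field) mpoly set \<Rightarrow> nat \<Rightarrow> nat" where
  "betti_quot I r = (THE n. \<exists>b s a d. minimal_graded_free_resolution I b s a d \<and> n = b r)"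


section \<open>Weighted oriented graphs\<close>

text \<open>The vertex set is the set of all elements of the (finite) type \<open>'v\<close>. The pair \<open>(x, y)\<close> is the
  edge oriented from \<open>x\<close> to \<open>y\<close>.\<close>

record 'v wograph =
  edges :: "('v \<times> 'v) set"
  weight :: "'v \<Rightarrow> nat"

definition weighted_oriented_graph :: "'v::finite wograph \<Rightarrow> bool" where
  "weighted_oriented_graph D \<longleftrightarrow>
    (\<forall>(x, y)\<in>edges D. x \<noteq> y \<and> (y, x) \<notin> edges D) \<and> (\<forall>v. weight D v \<ge> 1)"

definition edge_ideal :: "'v::finite wograph \<Rightarrow> ('v, 'k::field) mpoly set" where
  "edge_ideal D = Modules.module.span (*) {var x * var y ^ weight D y | x y. (x, y) \<in> edges D}"

text \<open>The underlying graph is the path \<open>x 1, \<dots>, x (n + 1)\<close>; the other values of \<open>x\<close> are irrelevant.\<close>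

definition weighted_oriented_path :: "nat \<Rightarrow> (nat \<Rightarrow> 'v::finite) \<Rightarrow> 'v wograph \<Rightarrow> bool" where
  "weighted_oriented_path n x P \<longleftrightarrow>
    weighted_oriented_graph P \<and>
    bij_betw x {1..n+1} UNIV \<and>
    (\<forall>i\<in>{1..n+1}. \<forall>j\<in>{1..n+1}.
      (x i, x j) \<in> edges P \<or> (x j, x i) \<in> edges P \<longleftrightarrow> j = i + 1 \<or> i = j + 1)"

definition is_sink :: "'v wograph \<Rightarrow> 'v \<Rightarrow> bool" where
  "is_sink D v \<longleftrightarrow> (\<forall>(x, y)\<in>edges D. v = x \<or> v = y \<longrightarrow> v = y)"

definition sink_graph :: "'v wograph \<Rightarrow> 'v wograph" where
  "sink_graph D = D\<lparr>weight := (\<lambda>v. if is_sink D v then 1 else weight D v)\<rparr>"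

definition iron_graph :: "nat \<Rightarrow> (nat \<Rightarrow> 'v) \<Rightarrow> 'v wograph \<Rightarrow> 'v wograph" where
  "iron_graph n x P =
    \<lparr>edges = {(x i, x (i + 1)) | i. i \<in> {1..n}},
     weight = (\<lambda>v. let i = the_inv_into {1..n+1} x v in
       if 1 < i \<and> (x i, x (i - 1)) \<in> edges (sink_graph P) then weight (sink_graph P) (x (i - 1))
       else weight (sink_graph P) v)\<rparr>"

end

theory Submission
  imports Defs "HOL-Library.Function_Algebras"
begin

text \<open>
  The three ideals are monomial ideals, and the Betti numbers of a monomial ideal can be read off
  from combinatorial data of its generators \<open>m k\<close>, \<open>k \<in> A\<close>. Call \<open>T \<subseteq> A\<close> closed if every generator that
  divides \<open>lcm {m k | k \<in> T}\<close> is indexed by an element of \<open>T\<close>; ordered by inclusion, the closed sets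
  form the lcm-lattice of the ideal. By a theorem of Gasharov, Peeva and Welker, the lattice
  determines the total Betti numbers, and together with the degrees of the least common multiples it
  determines the graded ones (\<open>betti_eq_of_closed_sets_eq\<close>).

  That theorem holds because a multigraded resolution is a complex of vector spaces in disguise. In
  multidegree \<open>t\<close> it only sees those basis vectors whose multidegree divides \<open>t\<close>. If the multidegrees
  are least common multiples of closed sets, these are the basis vectors whose closed set is
  contained in the closed set \<open>{k. m k divides t}\<close>. So all strands can be described by scalar matrices
  whose rows and columns are labelled by closed sets
  (\<open>resolution_frame\<close>). Such a frame exists for every finite family of label sets that contains the empty set
  (\<open>resolution_frame_exists\<close>): one repeatedly chooses minimal generators of the kernels, label by
  label (\<open>minimal_generators_exist\<close>). Replacing each label by the least common multiple that it
  stands for turns a frame into a minimal free resolution (\<open>minimal_resolution\<close>). The frame depends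
  on the lattice only, and so two ideals with the same lattice have resolutions with the
  same ranks, whose shifts are the degrees of the respective least common multiples.

  Since the Betti numbers are defined by means of an arbitrary minimal resolution, one also needs
  that all minimal resolutions have the same graded ranks (\<open>graded_rank_unique\<close>). This is the usual
  comparison argument: chain maps in both directions compose to maps homotopic to the identity, and
  for minimal complexes, homotopic maps are equal modulo the graded maximal ideal (\<open>comparison\<close>).

  For the graphs, passing from \<open>P\<close> to \<open>P_sink\<close> divides the exponents of each variable by a constant,
  because a sink has the same exponent in all generators in which it occurs; this does not change
  any divisibility
  (\<open>betti_quot_sink_graph\<close>). In \<open>P_sink\<close> and \<open>P_iron\<close> let \<open>e i\<close> be the weight of the head of the \<open>i\<close>-th
  edge, which is the same in both graphs, so that the \<open>i\<close>-th generator has degree \<open>1 + e i\<close> in both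
  ideals. If \<open>k \<notin> T\<close>, then in both graphs \<open>m k\<close> divides the least common multiple over \<open>T\<close> if and only if
  \<open>T\<close> contains \<open>k - 1\<close> and \<open>k + 1\<close> and \<open>e k = 1\<close>. The degree of the least common multiple is in both cases the sum of the \<open>e i\<close>
  for \<open>i \<in> T\<close> plus the number of maximal runs of consecutive elements of \<open>T\<close>
  (\<open>betti_straightened_path\<close>).
\<close>

section \<open>Monomials and homogeneous components\<close>

interpretation polynomial_ring: module "(*) :: ('v, 'k::comm_ring_1) mpoly \<Rightarrow> _ \<Rightarrow> _"
  by unfold_locales (simp_all add: algebra_simps)

text \<open>The order \<open>\<le>\<close> on exponent vectors is the lexicographic one, hence this separate relation.\<close>
definition divides :: "('v \<Rightarrow>\<^sub>0 nat) \<Rightarrow> ('v \<Rightarrow>\<^sub>0 nat) \<Rightarrow> bool" (infix \<open>divides\<close> 50) where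
  "s divides t \<longleftrightarrow> (\<forall>v. Poly_Mapping.lookup s v \<le> Poly_Mapping.lookup t v)"

lemma divides_add_diff: "s divides t \<Longrightarrow> s + (t - s) = t"
  by (intro poly_mapping_eqI) (simp add: divides_def lookup_add lookup_minus)

lemma divides_refl [simp]: "s divides s"
  by (simp add: divides_def)

lemma divides_trans [trans]: "s divides t \<Longrightarrow> t divides u \<Longrightarrow> s divides u"
  unfolding divides_def using le_trans by blast

lemma divides_antisym: "s divides t \<Longrightarrow> t divides s \<Longrightarrow> s = t"
  by (intro poly_mapping_eqI) (simp add: divides_def le_antisym)

lemma zero_divides [simp]: "0 divides t"
  by (simp add: divides_def)

lemma divides_zero_iff [simp]: "s divides 0 \<longleftrightarrow> s = 0"
  by (auto intro: divides_antisym)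

lemma monom_degree_sum:
  fixes t :: "'v::finite \<Rightarrow>\<^sub>0 nat"
  shows "monom_degree t = (\<Sum>v\<in>UNIV. Poly_Mapping.lookup t v)"
  unfolding monom_degree_def by (rule sum.mono_neutral_left) (auto simp: in_keys_iff)

lemma monom_degree_superset:
  assumes "finite A" "Poly_Mapping.keys t \<subseteq> A"
  shows "monom_degree t = (\<Sum>v\<in>A. Poly_Mapping.lookup t v)"
  unfolding monom_degree_def using assms by (intro sum.mono_neutral_left) (auto simp: in_keys_iff)

lemma monom_degree_zero [simp]: "monom_degree 0 = 0"
  by (simp add: monom_degree_def)

lemma monom_degree_add [simp]: "monom_degree (s + t) = monom_degree s + monom_degree t"
proof -
  have "monom_degree (s + t) = (\<Sum>v\<in>Poly_Mapping.keys s \<union> Poly_Mapping.keys t. Poly_Mapping.lookup (s + t) v)"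
    by (rule monom_degree_superset) (simp_all add: Poly_Mapping.keys_add)
  also have "\<dots> = (\<Sum>v\<in>Poly_Mapping.keys s \<union> Poly_Mapping.keys t. Poly_Mapping.lookup s v)
      + (\<Sum>v\<in>Poly_Mapping.keys s \<union> Poly_Mapping.keys t. Poly_Mapping.lookup t v)"
    by (simp add: lookup_add sum.distrib)
  also have "\<dots> = monom_degree s + monom_degree t"
    by (metis finite_Un finite_keys monom_degree_superset sup_ge1 sup_ge2)
  finally show ?thesis .
qed

lemma monom_degree_diff: "s divides t \<Longrightarrow> monom_degree s + monom_degree (t - s) = monom_degree t"
  by (metis divides_add_diff monom_degree_add)

lemma polynomial_sum_single:
  "p = (\<Sum>t\<in>Poly_Mapping.keys p. Poly_Mapping.single t (Poly_Mapping.lookup p t))"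
  by (intro poly_mapping_eqI) (auto simp: lookup_sum lookup_single when_def in_keys_iff)

lemma polynomial_induct [case_names add single]:
  fixes p :: "('v, 'k::comm_ring_1) mpoly"
  assumes add: "\<And>p q. Q p \<Longrightarrow> Q q \<Longrightarrow> Q (p + q)"
    and single: "\<And>t c. Q (Poly_Mapping.single t c)"
  shows "Q p"
proof -
  have "Q (\<Sum>t\<in>A. Poly_Mapping.single t (Poly_Mapping.lookup p t))" if "finite A" for A
    using that
  proof (induction A rule: finite_induct)
    case empty
    show ?case using single[of 0 0] by simp
  qed (use add single in auto)
  then show ?thesis
    by (subst polynomial_sum_single) simp
qed

lemma lookup_single_mult:
  fixes p :: "('v, 'k::comm_ring_1) mpoly"
  shows "Poly_Mapping.lookup (Poly_Mapping.single s c * p) t =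
    (if s divides t then c * Poly_Mapping.lookup p (t - s) else 0)"
proof (induction p rule: polynomial_induct)
  case (add p q)
  then show ?case by (simp add: algebra_simps lookup_add)
next
  case (single u e)
  have "s + u = t \<longleftrightarrow> s divides t \<and> u = t - s"
    by (auto simp: divides_add_diff divides_def lookup_add)
  then show ?case
    by (auto simp: mult_single lookup_single when_def)
qed

text \<open>Taking the constant coefficient is a ring homomorphism; below, it serves as reduction modulo
  the graded maximal ideal.\<close>
lemma lookup_mult_zero:
  fixes p q :: "('v, 'k::comm_ring_1) mpoly"
  shows "Poly_Mapping.lookup (p * q) 0 = Poly_Mapping.lookup p 0 * Poly_Mapping.lookup q 0"
proof (induction p rule: polynomial_induct)
  case (single t c)
  show ?case
    by (auto simp: lookup_single_mult lookup_single when_def)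
qed (simp add: algebra_simps lookup_add)

lemma irrelevant_ideal_constant_coeff:
  fixes p :: "('v, 'k::comm_ring_1) mpoly"
  assumes "p \<in> irrelevant_ideal"
  shows "Poly_Mapping.lookup p 0 = 0"
  using assms unfolding irrelevant_ideal_def
proof (induction rule: polynomial_ring.span_induct_alt)
  case (step c x y)
  then obtain v where "x = var v" by auto
  moreover have "Poly_Mapping.single v (1::nat) \<noteq> 0"
    by (metis lookup_single_eq lookup_zero zero_neq_one)
  ultimately have "Poly_Mapping.lookup x 0 = 0"
    by (simp add: var_def lookup_single when_def)
  with step show ?case
    by (simp add: lookup_add lookup_mult_zero)
qed simp

lemma single_in_irrelevant_ideal:
  fixes c :: "'k::comm_ring_1"
  assumes "t \<noteq> 0"
  shows "Poly_Mapping.single t c \<in> irrelevant_ideal"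
proof -
  from assms obtain v where v: "Poly_Mapping.lookup t v \<noteq> 0"
    by (metis lookup_zero poly_mapping_eqI)
  have "Poly_Mapping.single v 1 divides t"
    using v by (auto simp: divides_def lookup_single when_def)
  then have "Poly_Mapping.single t c = Poly_Mapping.single (t - Poly_Mapping.single v 1) c * var v"
    by (simp add: var_def mult_single add.commute divides_add_diff)
  then show ?thesis
    unfolding irrelevant_ideal_def by (simp add: polynomial_ring.span_base polynomial_ring.span_scale)
qed

definition hom_component :: "int \<Rightarrow> ('v, 'k::comm_ring_1) mpoly \<Rightarrow> ('v, 'k) mpoly" where
  "hom_component e p = (\<Sum>t\<in>{t\<in>Poly_Mapping.keys p. int (monom_degree t) = e}.
     Poly_Mapping.single t (Poly_Mapping.lookup p t))"

lemma lookup_hom_component: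
  "Poly_Mapping.lookup (hom_component e p) t = (if int (monom_degree t) = e then Poly_Mapping.lookup p t else 0)"
  by (auto simp: hom_component_def lookup_sum lookup_single when_def in_keys_iff)

lemma homogeneous_hom_component: "homogeneous e (hom_component e p)"
  by (auto simp: homogeneous_def in_keys_iff lookup_hom_component split: if_splits)

lemma hom_component_homogeneous: "homogeneous e p \<Longrightarrow> hom_component e p = p"
  by (rule poly_mapping_eqI) (metis homogeneous_def in_keys_iff lookup_hom_component)

lemma hom_component_add: "hom_component e (p + q) = hom_component e p + hom_component e q"
  by (rule poly_mapping_eqI) (simp add: lookup_hom_component lookup_add)

lemma hom_component_zero [simp]: "hom_component e 0 = 0"
  by (simp add: hom_component_def)

lemma hom_component_diff: "hom_component e (p - q) = hom_component e p - hom_component e q"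
  by (rule poly_mapping_eqI) (simp add: lookup_hom_component lookup_minus)

lemma hom_component_sum: "hom_component e (sum f A) = (\<Sum>x\<in>A. hom_component e (f x))"
  by (induction A rule: infinite_finite_induct) (simp_all add: hom_component_add)

text \<open>Multiplication by a homogeneous element is a graded map, so it commutes with taking
  components, up to the shift of degrees. This is what makes it possible to choose preimages under
  graded maps homogeneous.\<close>
lemma hom_component_mult:
  fixes p q :: "('v, 'k::comm_ring_1) mpoly"
  assumes "homogeneous d p"
  shows "hom_component e (p * q) = p * hom_component (e - d) q"
proof -
  have *: "hom_component e (Poly_Mapping.single s c * q) = Poly_Mapping.single s c * hom_component (e - d) q"
    if "int (monom_degree s) = d" for s c
  proof (rule poly_mapping_eqI)
    fix t
    show "Poly_Mapping.lookup (hom_component e (Poly_Mapping.single s c * q)) t =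
      Poly_Mapping.lookup (Poly_Mapping.single s c * hom_component (e - d) q) t"
    proof (cases "s divides t")
      case True
      then have "int (monom_degree t) = d + int (monom_degree (t - s))"
        using that monom_degree_diff[OF True] by linarith
      then show ?thesis
        by (auto simp: lookup_hom_component lookup_single_mult)
    qed (simp add: lookup_hom_component lookup_single_mult)
  qed
  have "hom_component e (p * q) =
    (\<Sum>t\<in>Poly_Mapping.keys p. hom_component e (Poly_Mapping.single t (Poly_Mapping.lookup p t) * q))"
    by (subst polynomial_sum_single[of p]) (simp only: sum_distrib_right hom_component_sum)
  also have "\<dots> = (\<Sum>t\<in>Poly_Mapping.keys p. Poly_Mapping.single t (Poly_Mapping.lookup p t) * hom_component (e - d) q)"
    using assms by (intro sum.cong refl *) (auto simp: homogeneous_def)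
  also have "\<dots> = p * hom_component (e - d) q"
    by (subst (3) polynomial_sum_single[of p]) (simp only: sum_distrib_right)
  finally show ?thesis .
qed

lemma homogeneous_constant_coeff: "homogeneous e p \<Longrightarrow> e \<noteq> 0 \<Longrightarrow> Poly_Mapping.lookup p 0 = 0"
  unfolding homogeneous_def by (metis in_keys_iff monom_degree_zero of_nat_0)

definition homogeneous_ideal :: "('v, 'k::comm_ring_1) mpoly set \<Rightarrow> bool" where
  "homogeneous_ideal I \<longleftrightarrow> (\<exists>S. (\<forall>p\<in>S. \<exists>e. homogeneous e p) \<and> I = polynomial_ring.span S)"

lemma homogeneous_ideal_hom_component:
  assumes "homogeneous_ideal I" "p \<in> I"
  shows "hom_component e p \<in> I"
proof -
  from assms(1) obtain S where S: "\<And>p. p \<in> S \<Longrightarrow> \<exists>e. homogeneous e p" and I: "I = polynomial_ring.span S"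
    by (auto simp: homogeneous_ideal_def)
  from assms(2) show ?thesis
    unfolding I
  proof (induction rule: polynomial_ring.span_induct_alt)
    case base
    show ?case by (simp add: polynomial_ring.span_zero)
  next
    case (step c x y)
    from S[OF step(1)] obtain d where "homogeneous d x" by auto
    then have "hom_component e (c * x) = hom_component (e - d) c * x"
      by (metis hom_component_mult mult.commute)
    with step show ?case
      by (simp add: hom_component_add polynomial_ring.span_add polynomial_ring.span_base polynomial_ring.span_scale)
  qed
qed

lemma homogeneous_ideal_subspace: "homogeneous_ideal I \<Longrightarrow> polynomial_ring.subspace I"
  by (auto simp: homogeneous_ideal_def)

section \<open>Minimal generators of a filtered vector space\<close>

interpretation coordinate_space: vector_space "\<lambda>c (f :: 'a \<Rightarrow> 'k::field) i. c * f i"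
  by unfold_locales (auto simp: algebra_simps)

lemma sum_fun_apply: "(\<Sum>i\<in>A. f i) x = (\<Sum>i\<in>A. f i x)"
  by (induction A rule: infinite_finite_induct) auto

lemma finite_support_in_span:
  fixes c :: "'a \<Rightarrow> 'k::field"
  assumes "finite A" "\<And>i. c i \<noteq> 0 \<Longrightarrow> i \<in> A"
  shows "c \<in> coordinate_space.span ((\<lambda>i k. if k = i then 1 else 0) ` A)"
proof -
  have "c = (\<Sum>i\<in>A. (\<lambda>k. c i * (if k = i then 1 else 0)))"
    using assms by (auto simp: fun_eq_iff sum_fun_apply if_distrib[of "(*) _"] cong: if_cong)
  also have "\<dots> \<in> coordinate_space.span ((\<lambda>i k. if k = i then 1 else 0) ` A)"
    by (intro coordinate_space.span_sum coordinate_space.span_scale coordinate_space.span_base) auto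
  finally show ?thesis .
qed

text \<open>If \<open>B\<close> is a left inverse of \<open>A\<close>, the columns of \<open>A\<close> are linearly independent vectors with
  coordinates indexed by \<open>K\<close>.\<close>
lemma card_le_of_left_inverse:
  fixes A B :: "nat \<Rightarrow> nat \<Rightarrow> 'k::field"
  assumes fin: "finite J" "finite K"
    and inv: "\<And>i j. i \<in> J \<Longrightarrow> j \<in> J \<Longrightarrow> (\<Sum>k\<in>K. B i k * A k j) = (if i = j then 1 else 0)"
  shows "card J \<le> card K"
proof -
  define f where "f j = (\<lambda>k. if k \<in> K then A k j else 0)" for j
  have f_inv: "(\<Sum>k\<in>K. B i k * f j k) = (if i = j then 1 else 0)" if "i \<in> J" "j \<in> J" for i j
    using inv[OF that] by (simp add: f_def)
  have inj: "inj_on f J"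
    by (rule inj_onI) (metis f_inv zero_neq_one)
  have "coordinate_space.independent (f ` J)"
  proof (rule coordinate_space.independent_if_scalars_zero)
    fix c x
    assume 0: "(\<Sum>x\<in>f ` J. (\<lambda>i. c x * x i)) = 0" and x: "x \<in> f ` J"
    then obtain i where i: "i \<in> J" "x = f i" by auto
    have "0 = (\<Sum>k\<in>K. B i k * (\<Sum>j\<in>J. c (f j) * f j k))"
      using fun_cong[OF 0] by (simp add: sum_fun_apply sum.reindex[OF inj])
    also have "\<dots> = (\<Sum>j\<in>J. c (f j) * (\<Sum>k\<in>K. B i k * f j k))"
      by (simp add: sum_distrib_left mult_ac) (rule sum.swap)
    also have "\<dots> = c x"
      using fin i by (simp add: f_inv if_distrib[of "(*) _"] cong: if_cong)
    finally show "c x = 0" by simp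
  qed (use fin in simp)
  moreover have "f ` J \<subseteq> coordinate_space.span ((\<lambda>i k. if k = i then 1 else 0) ` K)"
    by (auto intro!: finite_support_in_span fin simp: f_def split: if_splits)
  ultimately have "card (f ` J) \<le> card ((\<lambda>i k. if k = i then 1 else (0::'k)) ` K)"
    using coordinate_space.independent_span_bound fin by blast
  also have "\<dots> \<le> card K"
    by (rule card_image_le[OF fin(2)])
  finally show ?thesis
    by (simp add: card_image[OF inj])
qed

text \<open>A basis of \<open>S\<close> extends to one of \<open>V\<close>; the added vectors form the set \<open>G\<close>, which represents a
  basis of \<open>V / S\<close>.\<close>
lemma complement_basis:
  fixes S V :: "('a \<Rightarrow> 'k::field) set"
  assumes S: "coordinate_space.subspace S" "S \<subseteq> V"
    and V: "V \<subseteq> coordinate_space.span U" "finite U"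
  shows "\<exists>G. finite G \<and> G \<subseteq> V \<and> V \<subseteq> coordinate_space.span (S \<union> G) \<and>
    (\<forall>c. (\<Sum>g\<in>G. (\<lambda>k. c g * g k)) \<in> S \<longrightarrow> (\<forall>g\<in>G. c g = 0))"
proof -
  obtain B where B: "B \<subseteq> S" "coordinate_space.independent B" "S \<subseteq> coordinate_space.span B"
    by (metis coordinate_space.maximal_independent_subset)
  obtain B' where B': "B \<subseteq> B'" "B' \<subseteq> V" "coordinate_space.independent B'" "V \<subseteq> coordinate_space.span B'"
    using coordinate_space.maximal_independent_subset_extend[of B V] B S by blast
  have fin: "finite B'"
    using coordinate_space.independent_span_bound[OF V(2) B'(3)] B'(2) V(1) by blast
  have finB: "finite B"
    using fin B'(1) finite_subset by blast
  show ?thesis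
  proof (intro exI[of _ "B' - B"] conjI allI impI ballI)
    show "finite (B' - B)" "B' - B \<subseteq> V" using fin B' by auto
    show "V \<subseteq> coordinate_space.span (S \<union> (B' - B))"
    proof -
      have "B' \<subseteq> S \<union> (B' - B)" using B(1) by blast
      then show ?thesis
        using B'(4) coordinate_space.span_mono by blast
    qed
    fix c g
    assume in_S: "(\<Sum>g\<in>B' - B. (\<lambda>k. c g * g k)) \<in> S" and g: "g \<in> B' - B"
    from in_S B(3) have "(\<Sum>g\<in>B' - B. (\<lambda>k. c g * g k)) \<in> coordinate_space.span B" by auto
    then obtain u where u: "(\<Sum>g\<in>B' - B. (\<lambda>k. c g * g k)) = (\<Sum>g\<in>B. (\<lambda>k. u g * g k))"
      by (auto simp: coordinate_space.span_finite[OF finB])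
    define w where "w g = (if g \<in> B then - u g else c g)" for g
    have "(\<Sum>g\<in>B'. (\<lambda>k. w g * g k)) = (\<Sum>g\<in>B' - B. (\<lambda>k. w g * g k)) + (\<Sum>g\<in>B. (\<lambda>k. w g * g k))"
      by (rule sum.subset_diff) (use fin B' in auto)
    also have "(\<Sum>g\<in>B' - B. (\<lambda>k. w g * g k)) = (\<Sum>g\<in>B' - B. (\<lambda>k. c g * g k))"
      by (rule sum.cong) (auto simp: w_def)
    also have "(\<Sum>g\<in>B. (\<lambda>k. w g * g k)) = - (\<Sum>g\<in>B. (\<lambda>k. u g * g k))"
      by (simp add: w_def fun_eq_iff sum_fun_apply sum_negf)
    finally have "(\<Sum>g\<in>B'. (\<lambda>k. w g * g k)) = 0"
      using u by (simp add: zero_fun_def)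
    then have "w g = 0"
      using coordinate_space.independentD[OF B'(3) fin order_refl] g by blast
    then show "c g = 0" using g by (simp add: w_def)
  qed
qed

definition supported :: "nat \<Rightarrow> (nat \<Rightarrow> 'l::order) \<Rightarrow> 'l \<Rightarrow> (nat \<Rightarrow> 'k::zero) \<Rightarrow> bool" where
  "supported b \<mu> T c \<longleftrightarrow> (\<forall>j. c j \<noteq> 0 \<longrightarrow> j < b \<and> \<mu> j \<le> T)"

lemma supported_mono: "supported b \<mu> S c \<Longrightarrow> S \<le> T \<Longrightarrow> supported b \<mu> T c"
  by (auto simp: supported_def intro: order_trans)

text \<open>
  The subspaces \<open>K T\<close>, increasing in the label \<open>T\<close>, form a functor from the poset \<open>\<T>\<close> to vector
  spaces; the labelled vectors \<open>g j\<close> define a map to it from the free functor that has one generator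
  in each label \<open>\<mu> j\<close>. The second clause says that this map is onto. The third clause is
  minimality, since a generator that occurs in a relation of its own label can be expressed by
  the others and left out.
\<close>
definition minimal_generators ::
  "'l::order set \<Rightarrow> ('l \<Rightarrow> ('a \<Rightarrow> 'k::field) set) \<Rightarrow> nat \<Rightarrow> (nat \<Rightarrow> 'l) \<Rightarrow> (nat \<Rightarrow> 'a \<Rightarrow> 'k) \<Rightarrow> bool" where
  "minimal_generators \<T> K b \<mu> g \<longleftrightarrow>
    (\<forall>j<b. \<mu> j \<in> \<T> \<and> g j \<in> K (\<mu> j)) \<and>
    (\<forall>T\<in>\<T>. \<forall>x\<in>K T. \<exists>c. supported b \<mu> T c \<and> (\<forall>k. x k = (\<Sum>j<b. c j * g j k))) \<and>
    (\<forall>T\<in>\<T>. \<forall>c. supported b \<mu> T c \<longrightarrow> (\<forall>k. (\<Sum>j<b. c j * g j k) = 0) \<longrightarrow> (\<forall>j. \<mu> j = T \<longrightarrow> c j = 0))"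

lemma subspace_combinations:
  "coordinate_space.subspace {x :: 'a \<Rightarrow> 'k::field. \<exists>c. supported b \<mu> T c \<and> (\<forall>k. x k = (\<Sum>j<b. c j * g j k))}"
  (is "coordinate_space.subspace ?W")
proof (rule coordinate_space.subspaceI)
  show "0 \<in> ?W"
    by (auto intro!: exI[of _ "\<lambda>_. 0"] simp: supported_def)
next
  fix x y assume "x \<in> ?W" "y \<in> ?W"
  then obtain c e where "supported b \<mu> T c" "\<forall>k. x k = (\<Sum>j<b. c j * g j k)"
    "supported b \<mu> T e" "\<forall>k. y k = (\<Sum>j<b. e j * g j k)" by auto
  then show "x + y \<in> ?W"
    by (auto intro!: exI[of _ "\<lambda>j. c j + e j"] simp: supported_def algebra_simps sum.distrib)
      (metis add.right_neutral)+
next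
  fix a x assume "x \<in> ?W"
  then obtain c where "supported b \<mu> T c" "\<forall>k. x k = (\<Sum>j<b. c j * g j k)" by auto
  then show "(\<lambda>k. a * x k) \<in> ?W"
    by (auto intro!: exI[of _ "\<lambda>j. a * c j"] simp: supported_def algebra_simps sum_distrib_left)
qed

text \<open>In each label \<open>T\<close> one takes representatives of a basis of \<open>K T\<close> modulo what comes from
  smaller labels. They generate by induction on the poset, and they are minimal because they
  are independent modulo the contributions of the smaller labels.\<close>
lemma minimal_generators_exist:
  fixes \<T> :: "'l::order set" and K :: "'l \<Rightarrow> ('a \<Rightarrow> 'k::field) set"
  assumes fin: "finite \<T>"
    and sub: "\<And>T. T \<in> \<T> \<Longrightarrow> coordinate_space.subspace (K T)"
    and fin_dim: "finite U" "\<And>T. T \<in> \<T> \<Longrightarrow> K T \<subseteq> coordinate_space.span U"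
    and mono: "\<And>S T. S \<in> \<T> \<Longrightarrow> T \<in> \<T> \<Longrightarrow> S \<le> T \<Longrightarrow> K S \<subseteq> K T"
  obtains b \<mu> g where "minimal_generators \<T> K b \<mu> g"
proof -
  define D where "D T = coordinate_space.span (\<Union>S\<in>{S\<in>\<T>. S < T}. K S)" for T
  have D_sub: "D T \<subseteq> K T" if "T \<in> \<T>" for T
    unfolding D_def using that mono sub
    by (intro coordinate_space.span_minimal UN_least) (auto dest: less_imp_le)
  have "\<forall>T\<in>\<T>. \<exists>G. finite G \<and> G \<subseteq> K T \<and> K T \<subseteq> coordinate_space.span (D T \<union> G) \<and>
    (\<forall>c. (\<Sum>g\<in>G. (\<lambda>k. c g * g k)) \<in> D T \<longrightarrow> (\<forall>g\<in>G. c g = 0))"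
    using D_sub fin_dim unfolding D_def
    by (intro ballI complement_basis[of _ _ U] coordinate_space.subspace_span) auto
  from bchoice[OF this] obtain G
    where "\<forall>T\<in>\<T>. finite (G T) \<and> G T \<subseteq> K T \<and> K T \<subseteq> coordinate_space.span (D T \<union> G T) \<and>
    (\<forall>c. (\<Sum>g\<in>G T. (\<lambda>k. c g * g k)) \<in> D T \<longrightarrow> (\<forall>g\<in>G T. c g = 0))" by blast
  then have G: "\<And>T. T \<in> \<T> \<Longrightarrow> finite (G T)" "\<And>T. T \<in> \<T> \<Longrightarrow> G T \<subseteq> K T"
    "\<And>T. T \<in> \<T> \<Longrightarrow> K T \<subseteq> coordinate_space.span (D T \<union> G T)"
    "\<And>T c g. T \<in> \<T> \<Longrightarrow> (\<Sum>g\<in>G T. (\<lambda>k. c g * g k)) \<in> D T \<Longrightarrow> g \<in> G T \<Longrightarrow> c g = 0"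
    by auto
  \<comment> \<open>The same vector may be a generator for several incomparable labels, so generators are
    pairs of a label and a vector.\<close>
  define P where "P = Sigma \<T> G"
  have "finite P" unfolding P_def using fin G(1) by blast
  then obtain f where f: "bij_betw f {..<card P} P"
    using ex_bij_betw_nat_finite[of P] by (auto simp: atLeast0LessThan)
  define b where "b = card P"
  define \<mu> where "\<mu> j = fst (f j)" for j
  define g where "g j = snd (f j)" for j
  define W where "W T = {x. \<exists>c. supported b \<mu> T c \<and> (\<forall>k. x k = (\<Sum>j<b. c j * g j k))}" for T
  have gen: "\<mu> j \<in> \<T> \<and> g j \<in> G (\<mu> j)" if "j < b" for j
  proof -
    have "f j \<in> P" using f that by (auto simp: bij_betw_def b_def)
    then show ?thesis by (auto simp: P_def \<mu>_def g_def)
  qed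
  have bij: "bij_betw g {j. j < b \<and> \<mu> j = T} (G T)" if "T \<in> \<T>" for T
  proof -
    have "bij_betw f {j. j < b \<and> \<mu> j = T} ({T} \<times> G T)"
      unfolding bij_betw_def
    proof
      show "inj_on f {j. j < b \<and> \<mu> j = T}"
        using f by (auto simp: bij_betw_def b_def intro: inj_on_subset)
      show "f ` {j. j < b \<and> \<mu> j = T} = {T} \<times> G T"
      proof
        show "f ` {j. j < b \<and> \<mu> j = T} \<subseteq> {T} \<times> G T"
        proof
          fix p assume "p \<in> f ` {j. j < b \<and> \<mu> j = T}"
          then obtain j where j: "j < b" "\<mu> j = T" "p = f j" by auto
          then show "p \<in> {T} \<times> G T"
            using gen[of j] by (cases "f j") (auto simp: \<mu>_def g_def)
        qed
        show "{T} \<times> G T \<subseteq> f ` {j. j < b \<and> \<mu> j = T}"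
        proof
          fix p assume p: "p \<in> {T} \<times> G T"
          then have "p \<in> P" using that by (auto simp: P_def)
          then obtain j where "j < b" "p = f j" using f by (auto simp: bij_betw_def b_def)
          then show "p \<in> f ` {j. j < b \<and> \<mu> j = T}" using p by (auto simp: \<mu>_def)
        qed
      qed
    qed
    moreover have "bij_betw snd ({T} \<times> G T) (G T)"
      by (auto simp: bij_betw_def inj_on_def image_iff)
    ultimately show ?thesis
      using bij_betw_trans unfolding g_def comp_def by fastforce
  qed
  have W_mono: "W S \<subseteq> W T" if "S \<le> T" for S T
    using that supported_mono unfolding W_def by blast
  have W_sub: "coordinate_space.subspace (W T)" for T
    unfolding W_def by (rule subspace_combinations)
  have K_W: "K T \<subseteq> W T" if "T \<in> \<T>" for T
    using that
  proof (induction "card {S\<in>\<T>. S < T}" arbitrary: T rule: less_induct)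
    case less
    have "K S \<subseteq> W T" if "S \<in> \<T>" "S < T" for S
    proof -
      have "card {R\<in>\<T>. R < S} < card {R\<in>\<T>. R < T}"
        by (rule psubset_card_mono) (use fin that in \<open>auto intro: less_trans\<close>)
      then show ?thesis
        using less.hyps[OF _ that(1)] W_mono[OF less_imp_le[OF that(2)]] by blast
    qed
    then have "D T \<subseteq> W T"
      unfolding D_def by (intro coordinate_space.span_minimal UN_least W_sub) auto
    moreover have "G T \<subseteq> W T"
    proof
      fix v assume "v \<in> G T"
      then obtain j where j: "j < b" "\<mu> j = T" "v = g j"
        using bij[OF less.prems] by (auto simp: bij_betw_def)
      then show "v \<in> W T"
        by (auto simp: W_def supported_def if_distrib[of "\<lambda>c. c * _"] cong: if_cong split: if_splits
            intro!: exI[of _ "\<lambda>i. if i = j then 1 else 0"])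
    qed
    ultimately show "K T \<subseteq> W T"
      using coordinate_space.span_minimal[OF _ W_sub] G(3)[OF less.prems] by (meson Un_least subset_trans)
  qed
  have "minimal_generators \<T> K b \<mu> g"
    unfolding minimal_generators_def
  proof (intro conjI allI impI ballI)
    fix j assume "j < b"
    then show "\<mu> j \<in> \<T>" "g j \<in> K (\<mu> j)" using gen G(2) by auto
  next
    fix T x assume "T \<in> \<T>" "x \<in> K T"
    then show "\<exists>c. supported b \<mu> T c \<and> (\<forall>k. x k = (\<Sum>j<b. c j * g j k))"
      using K_W W_def by auto
  next
    fix T c j
    assume T: "T \<in> \<T>" and c: "supported b \<mu> T c" and 0: "\<forall>k. (\<Sum>j<b. c j * g j k) = 0" and j: "\<mu> j = T"
    let ?A = "{j. j < b \<and> \<mu> j = T}"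
    have "(\<Sum>j\<in>?A. (\<lambda>k. c j * g j k)) + (\<Sum>j\<in>{..<b} - ?A. (\<lambda>k. c j * g j k)) = (\<Sum>j<b. (\<lambda>k. c j * g j k))"
      by (subst add.commute, rule sum.subset_diff[symmetric]) auto
    also have "\<dots> = 0"
      using 0 by (simp add: fun_eq_iff sum_fun_apply)
    finally have "(\<Sum>j\<in>?A. (\<lambda>k. c j * g j k)) = - (\<Sum>j\<in>{..<b} - ?A. (\<lambda>k. c j * g j k))"
      by (simp add: eq_neg_iff_add_eq_0)
    also have "\<dots> \<in> D T"
      unfolding D_def
    proof (intro coordinate_space.span_neg coordinate_space.span_sum)
      fix i assume i: "i \<in> {..<b} - ?A"
      show "(\<lambda>k. c i * g i k) \<in> coordinate_space.span (\<Union>S\<in>{S \<in> \<T>. S < T}. K S)"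
      proof (cases "c i = 0")
        case True
        then show ?thesis
          using coordinate_space.span_zero by (simp add: zero_fun_def)
      next
        case False
        then have "\<mu> i < T" using c i by (auto simp: supported_def)
        then show ?thesis
          using i gen[of i] G(2)
          by (intro coordinate_space.span_scale coordinate_space.span_base) blast
      qed
    qed
    also have "(\<Sum>j\<in>?A. (\<lambda>k. c j * g j k)) = (\<Sum>v\<in>G T. (\<lambda>k. c (the_inv_into ?A g v) * v k))"
      using bij[OF T]
      by (subst sum.reindex_bij_betw[OF bij[OF T], symmetric])
        (rule sum.cong, auto simp: bij_betw_def the_inv_into_f_f)
    finally have *: "c (the_inv_into ?A g v) = 0" if "v \<in> G T" for v
      using G(4)[OF T, of "\<lambda>v. c (the_inv_into ?A g v)"] that by blast
    show "c j = 0"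
    proof (cases "j < b")
      case True
      then have "j \<in> ?A" using j by simp
      then show ?thesis
        using *[of "g j"] bij[OF T] by (auto simp: bij_betw_def the_inv_into_f_f)
    next
      case False
      then show ?thesis using c by (auto simp: supported_def)
    qed
  qed
  then show thesis by (rule that)
qed

section \<open>Uniqueness of minimal graded free resolutions\<close>

text \<open>The matrix describes a degree-preserving map when the basis vectors of the target have the
  degrees \<open>s\<close> and those of the source have the degrees \<open>t\<close>.\<close>
definition graded_matrix :: "(nat \<Rightarrow> int) \<Rightarrow> (nat \<Rightarrow> int) \<Rightarrow> ('v, 'k::zero) mpoly mat \<Rightarrow> bool" where
  "graded_matrix s t M \<longleftrightarrow>
    (\<forall>k<dim_row M. \<forall>j<dim_col M. homogeneous (t j - s k) (M $$ (k, j)))"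

lemma matrix_lift:
  fixes D M :: "'a::comm_ring_1 mat"
  assumes D: "D \<in> carrier_mat p q" and M: "M \<in> carrier_mat p r"
    and im: "\<And>j. j < r \<Longrightarrow> \<exists>c\<in>carrier_vec q. D *\<^sub>v c = col M j"
  obtains N where "N \<in> carrier_mat q r" "D * N = M"
proof -
  from im obtain c where c: "\<And>j. j < r \<Longrightarrow> c j \<in> carrier_vec q \<and> D *\<^sub>v c j = col M j"
    by metis
  define N where "N = mat q r (\<lambda>(l, j). c j $ l)"
  have N: "N \<in> carrier_mat q r" by (simp add: N_def)
  have col_N: "col N j = c j" if "j < r" for j
    using c[OF that] that by (auto simp: N_def)
  have "D * N = M"
  proof (rule mat_col_eqI)
    fix j assume "j < dim_col M"
    then have j: "j < r" using M by simp
    then show "col (D * N) j = col M j"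
      using col_mult2[OF D N j] col_N[OF j] c[OF j] by simp
  qed (use D M N in auto)
  with N show thesis by (rule that)
qed

lemma mult_unit_vec:
  fixes A :: "'a::comm_ring_1 mat"
  assumes "A \<in> carrier_mat p q" "j < q"
  shows "A *\<^sub>v unit_vec q j = col A j"
  using assms by - (rule eq_vecI, auto)

lemma col_minus_one:
  fixes A :: "'a::comm_ring_1 mat"
  assumes "A \<in> carrier_mat n n" "j < n"
  shows "col (A - 1\<^sub>m n) j = col A j - unit_vec n j"
  using assms by - (rule eq_vecI, auto)

lemma add_diff_cancel_mat:
  fixes X Y Z :: "'a::comm_ring_1 mat"
  assumes "X \<in> carrier_mat n n" "Y \<in> carrier_mat n n" "Z \<in> carrier_mat n n"
  shows "X = Y + ((X - (Y + Z)) + Z)"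
  using assms by - (rule eq_matI, auto)

text \<open>Any lift can be made graded: replace each entry by its component of the required degree.\<close>
lemma graded_matrix_lift:
  fixes D M :: "('v, 'k::comm_ring_1) mpoly mat"
  assumes D: "D \<in> carrier_mat p q" "graded_matrix s t D"
    and M: "M \<in> carrier_mat p r" "graded_matrix s u M"
    and im: "\<And>j. j < r \<Longrightarrow> \<exists>c\<in>carrier_vec q. D *\<^sub>v c = col M j"
  obtains N where "N \<in> carrier_mat q r" "graded_matrix t u N" "D * N = M"
proof -
  obtain N0 where N0: "N0 \<in> carrier_mat q r" "D * N0 = M"
    using matrix_lift[OF D(1) M(1) im] by blast
  define N where "N = mat q r (\<lambda>(l, j). hom_component (u j - t l) (N0 $$ (l, j)))"
  have N: "N \<in> carrier_mat q r" by (simp add: N_def)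
  have "D * N = M"
  proof (rule eq_matI)
    fix k j assume "k < dim_row M" "j < dim_col M"
    then have kj: "k < p" "j < r" using M by auto
    have "(D * N) $$ (k, j) = (\<Sum>l<q. D $$ (k, l) * hom_component (u j - t l) (N0 $$ (l, j)))"
      using kj D N by (auto simp: scalar_prod_def N_def atLeast0LessThan)
    also have "\<dots> = (\<Sum>l<q. hom_component (u j - s k) (D $$ (k, l) * N0 $$ (l, j)))"
    proof (intro sum.cong refl)
      fix l assume "l \<in> {..<q}"
      then have "homogeneous (t l - s k) (D $$ (k, l))"
        using D kj by (auto simp: graded_matrix_def)
      then show "D $$ (k, l) * hom_component (u j - t l) (N0 $$ (l, j)) =
        hom_component (u j - s k) (D $$ (k, l) * N0 $$ (l, j))"
        by (simp add: hom_component_mult)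
    qed
    also have "\<dots> = hom_component (u j - s k) ((D * N0) $$ (k, j))"
      using kj D N0 by (auto simp: scalar_prod_def atLeast0LessThan hom_component_sum)
    also have "\<dots> = M $$ (k, j)"
      unfolding N0(2) using M kj by (intro hom_component_homogeneous) (auto simp: graded_matrix_def)
    finally show "(D * N) $$ (k, j) = M $$ (k, j)" .
  qed (use D M N in auto)
  moreover have "graded_matrix t u N"
    by (auto simp: graded_matrix_def N_def homogeneous_hom_component)
  ultimately show thesis using N that by blast
qed

lemma graded_matrix_mult:
  fixes M N :: "('v, 'k::comm_ring_1) mpoly mat"
  assumes M: "M \<in> carrier_mat p q" "graded_matrix s t M"
    and N: "N \<in> carrier_mat q r" "graded_matrix t u N"
  shows "graded_matrix s u (M * N)"
proof -
  have "hom_component (u j - s k) ((M * N) $$ (k, j)) = (M * N) $$ (k, j)" if "k < p" "j < r" for k j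
  proof -
    have "hom_component (u j - s k) (M $$ (k, l) * N $$ (l, j)) = M $$ (k, l) * N $$ (l, j)" if "l < q" for l
    proof -
      have "homogeneous (t l - s k) (M $$ (k, l))" "homogeneous (u j - t l) (N $$ (l, j))"
        using that \<open>k < p\<close> \<open>j < r\<close> M N by (auto simp: graded_matrix_def)
      then show ?thesis
        by (simp add: hom_component_mult hom_component_homogeneous)
    qed
    then show ?thesis
      using that M N by (auto simp: scalar_prod_def hom_component_sum)
  qed
  then show ?thesis
    using M N unfolding graded_matrix_def
    by (metis carrier_matD(1,2) homogeneous_hom_component index_mult_mat(2,3))
qed

context graded_free_resolution
begin

lemma graded_differential: "graded_matrix (s i) (s (Suc i)) (d i)"
  using diff_homogeneous diff_carrier[of i] by (auto simp: graded_matrix_def)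

lemma differential_in_kernel:
  assumes "c \<in> carrier_vec (b (Suc (Suc i)))"
  shows "d i *\<^sub>v (d (Suc i) *\<^sub>v c) = 0\<^sub>v (b i)"
proof -
  have "d (Suc i) *\<^sub>v c \<in> mat_kernel (d i)"
    using exact_Suc[of i] assms by auto
  then show ?thesis
    using diff_carrier[of i] by (auto simp: mat_kernel_def)
qed

lemma differential_squared: "d i * d (Suc i) = 0\<^sub>m (b i) (b (Suc (Suc i)))"
proof (rule mat_col_eqI)
  fix j assume "j < dim_col (0\<^sub>m (b i) (b (Suc (Suc i))) :: ('v, 'k) mpoly mat)"
  then have j: "j < b (Suc (Suc i))" by simp
  have "col (d i * d (Suc i)) j = d i *\<^sub>v col (d (Suc i)) j"
    by (rule col_mult2[OF diff_carrier diff_carrier j])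
  also have "col (d (Suc i)) j = d (Suc i) *\<^sub>v unit_vec (b (Suc (Suc i))) j"
    using mult_unit_vec[OF diff_carrier[of "Suc i"] j] by simp
  also have "d i *\<^sub>v \<dots> = 0\<^sub>v (b i)"
    by (rule differential_in_kernel) simp
  finally show "col (d i * d (Suc i)) j = col (0\<^sub>m (b i) (b (Suc (Suc i)))) j"
    using j by simp
qed (use diff_carrier[of i] diff_carrier[of "Suc i"] in auto)

lemma kernel_lift:
  assumes M: "M \<in> carrier_mat (b (Suc i)) r" and 0: "d i * M = 0\<^sub>m (b i) r" and j: "j < r"
  shows "\<exists>c\<in>carrier_vec (b (Suc (Suc i))). d (Suc i) *\<^sub>v c = col M j"
proof -
  have "d i *\<^sub>v col M j = col (d i * M) j"
    using col_mult2[OF diff_carrier M j] by simp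
  then have "col M j \<in> mat_kernel (d i)"
    using 0 M j diff_carrier[of i] by (auto simp: mat_kernel_def)
  then have "col M j \<in> {d (Suc i) *\<^sub>v c |c. c \<in> carrier_vec (b (Suc (Suc i)))}"
    unfolding exact_Suc .
  then show ?thesis by auto
qed

lemma augmentation_lift:
  assumes M: "M \<in> carrier_mat (b 0) r" and aug: "\<And>j. j < r \<Longrightarrow> a \<bullet> col M j \<in> I" and j: "j < r"
  shows "\<exists>c\<in>carrier_vec (b (Suc 0)). d 0 *\<^sub>v c = col M j"
proof -
  have "col M j \<in> {c \<in> carrier_vec (b 0). a \<bullet> c \<in> I}"
    using M aug[OF j] j by auto
  then have "col M j \<in> {d 0 *\<^sub>v c |c. c \<in> carrier_vec (b 1)}"
    unfolding exact_0 .
  then show ?thesis by auto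
qed

end

lemma scalar_prod_sum: "v \<in> carrier_vec n \<Longrightarrow> w \<in> carrier_vec n \<Longrightarrow> v \<bullet> w = (\<Sum>i<n. v $ i * w $ i)"
  by (simp add: scalar_prod_def atLeast0LessThan)

text \<open>The beginning of a comparison map: a degree-preserving \<open>\<phi>\<close> between the modules in
  homological degree 0 that induces the identity on \<open>R/I\<close>.\<close>
lemma augmentation_lift_of_identity:
  fixes I :: "('v, 'k::field) mpoly set"
  assumes F: "graded_free_resolution I b s a d" and G: "graded_free_resolution I b' s' a' d'"
    and I: "homogeneous_ideal I"
  obtains \<phi> where "\<phi> \<in> carrier_mat (b' 0) (b 0)" "graded_matrix (s' 0) (s 0) \<phi>"
    "\<And>x. x \<in> carrier_vec (b 0) \<Longrightarrow> a' \<bullet> (\<phi> *\<^sub>v x) - a \<bullet> x \<in> I"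
proof -
  interpret F: graded_free_resolution I b s a d by (rule F)
  interpret G: graded_free_resolution I b' s' a' d' by (rule G)
  have sub: "polynomial_ring.subspace I" by (rule homogeneous_ideal_subspace[OF I])
  from G.aug_surj obtain c where c: "\<And>f. c f \<in> carrier_vec (b' 0)" "\<And>f. f - a' \<bullet> c f \<in> I"
    by metis
  define \<phi> where "\<phi> = mat (b' 0) (b 0) (\<lambda>(l, j). hom_component (s 0 j - s' 0 l) (c (a $ j) $ l))"
  have \<phi>: "\<phi> \<in> carrier_mat (b' 0) (b 0)" by (simp add: \<phi>_def)
  have gr: "graded_matrix (s' 0) (s 0) \<phi>"
    by (auto simp: graded_matrix_def \<phi>_def homogeneous_hom_component)
  have basis: "(\<Sum>l<b' 0. a' $ l * \<phi> $$ (l, j)) - a $ j \<in> I" if j: "j < b 0" for j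
  proof -
    have "hom_component (s 0 j) (a $ j - a' \<bullet> c (a $ j)) \<in> I"
      by (rule homogeneous_ideal_hom_component[OF I c(2)])
    moreover have "hom_component (s 0 j) (a' \<bullet> c (a $ j)) = (\<Sum>l<b' 0. a' $ l * \<phi> $$ (l, j))"
      unfolding scalar_prod_sum[OF G.aug_carrier c(1)] hom_component_sum
      using j by (intro sum.cong refl) (simp add: \<phi>_def hom_component_mult[OF G.aug_homogeneous])
    ultimately have "a $ j - (\<Sum>l<b' 0. a' $ l * \<phi> $$ (l, j)) \<in> I"
      by (simp add: hom_component_diff hom_component_homogeneous[OF F.aug_homogeneous[OF j]])
    then show ?thesis
      using polynomial_ring.subspace_neg[OF sub] by fastforce
  qed
  show thesis
  proof (rule that[OF \<phi> gr])
    fix x :: "('v, 'k) mpoly vec" assume x: "x \<in> carrier_vec (b 0)"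
    have \<phi>x: "\<phi> *\<^sub>v x \<in> carrier_vec (b' 0)" by (rule mult_mat_vec_carrier[OF \<phi> x])
    have "(\<phi> *\<^sub>v x) $ l = (\<Sum>j<b 0. \<phi> $$ (l, j) * x $ j)" if "l < b' 0" for l
    proof -
      have "(\<phi> *\<^sub>v x) $ l = row \<phi> l \<bullet> x"
        using that \<phi> by (intro index_mult_mat_vec) simp
      also have "\<dots> = (\<Sum>j<b 0. row \<phi> l $ j * x $ j)"
        using that \<phi> x by (intro scalar_prod_sum) auto
      finally show ?thesis
        using that \<phi> by simp
    qed
    then have "a' \<bullet> (\<phi> *\<^sub>v x) = (\<Sum>l<b' 0. a' $ l * (\<Sum>j<b 0. \<phi> $$ (l, j) * x $ j))"
      unfolding scalar_prod_sum[OF G.aug_carrier \<phi>x] by (intro sum.cong) auto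
    also have "\<dots> = (\<Sum>l<b' 0. \<Sum>j<b 0. x $ j * (a' $ l * \<phi> $$ (l, j)))"
      unfolding sum_distrib_left by (intro sum.cong refl) (simp only: mult.commute mult.left_commute)
    also have "\<dots> = (\<Sum>j<b 0. \<Sum>l<b' 0. x $ j * (a' $ l * \<phi> $$ (l, j)))"
      by (rule sum.swap)
    also have "\<dots> = (\<Sum>j<b 0. x $ j * (\<Sum>l<b' 0. a' $ l * \<phi> $$ (l, j)))"
      by (simp only: sum_distrib_left)
    also have "\<dots> - a \<bullet> x = (\<Sum>j<b 0. x $ j * (\<Sum>l<b' 0. a' $ l * \<phi> $$ (l, j)) - a $ j * x $ j)"
      by (simp only: scalar_prod_sum[OF F.aug_carrier x] sum_subtractf)
    also have "\<dots> = (\<Sum>j<b 0. x $ j * ((\<Sum>l<b' 0. a' $ l * \<phi> $$ (l, j)) - a $ j))"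
      by (intro sum.cong refl) (simp only: right_diff_distrib mult.commute)
    also have "\<dots> \<in> I"
      by (intro polynomial_ring.subspace_sum[OF sub] polynomial_ring.subspace_scale[OF sub] basis) auto
    finally show "a' \<bullet> (\<phi> *\<^sub>v x) - a \<bullet> x \<in> I" .
  qed
qed

text \<open>Instead of whole chain maps it suffices to deal with a single component \<open>\<phi>\<close> in homological
  degree \<open>i\<close>, provided that it is known to extend to degree \<open>i + 1\<close>; this makes the comparison theorem
  a plain induction.\<close>
definition lifts_one_step :: "(nat \<Rightarrow> nat) \<Rightarrow> (nat \<Rightarrow> nat \<Rightarrow> int) \<Rightarrow> (nat \<Rightarrow> ('v, 'k::comm_ring_1) mpoly mat) \<Rightarrow>
  (nat \<Rightarrow> nat) \<Rightarrow> (nat \<Rightarrow> nat \<Rightarrow> int) \<Rightarrow> (nat \<Rightarrow> ('v, 'k) mpoly mat) \<Rightarrow> nat \<Rightarrow> ('v, 'k) mpoly mat \<Rightarrow> bool" where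
  "lifts_one_step b s d b' s' d' i \<phi> \<longleftrightarrow> \<phi> \<in> carrier_mat (b' i) (b i) \<and> graded_matrix (s' i) (s i) \<phi> \<and>
    (\<exists>\<phi>'\<in>carrier_mat (b' (Suc i)) (b (Suc i)). graded_matrix (s' (Suc i)) (s (Suc i)) \<phi>' \<and> \<phi> * d i = d' i * \<phi>')"

lemma lifts_one_step_0:
  fixes I :: "('v, 'k::field) mpoly set"
  assumes F: "graded_free_resolution I b s a d" and G: "graded_free_resolution I b' s' a' d'"
    and I: "homogeneous_ideal I"
    and \<phi>: "\<phi> \<in> carrier_mat (b' 0) (b 0)" "graded_matrix (s' 0) (s 0) \<phi>"
      "\<And>x. x \<in> carrier_vec (b 0) \<Longrightarrow> a' \<bullet> (\<phi> *\<^sub>v x) - a \<bullet> x \<in> I"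
  shows "lifts_one_step b s d b' s' d' 0 \<phi>"
proof -
  interpret F: graded_free_resolution I b s a d by (rule F)
  interpret G: graded_free_resolution I b' s' a' d' by (rule G)
  have sub: "polynomial_ring.subspace I" by (rule homogeneous_ideal_subspace[OF I])
  have M: "\<phi> * d 0 \<in> carrier_mat (b' 0) (b (Suc 0))"
    using \<phi>(1) F.diff_carrier[of 0] by (rule mult_carrier_mat)
  have "a' \<bullet> col (\<phi> * d 0) j \<in> I" if j: "j < b (Suc 0)" for j
  proof -
    have "col (d 0) j = d 0 *\<^sub>v unit_vec (b (Suc 0)) j"
      using mult_unit_vec[OF F.diff_carrier[of 0] j] by simp
    then have "col (d 0) j \<in> {d 0 *\<^sub>v c | c. c \<in> carrier_vec (b 1)}"
      by auto
    then have x: "col (d 0) j \<in> carrier_vec (b 0)" "a \<bullet> col (d 0) j \<in> I"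
      unfolding F.exact_0 by auto
    have "a' \<bullet> (\<phi> *\<^sub>v col (d 0) j) - a \<bullet> col (d 0) j + a \<bullet> col (d 0) j \<in> I"
      by (intro polynomial_ring.subspace_add[OF sub] \<phi>(3) x)
    then show ?thesis
      using col_mult2[OF \<phi>(1) F.diff_carrier[of 0] j] by simp
  qed
  from G.augmentation_lift[OF M this]
  obtain \<phi>' where "\<phi>' \<in> carrier_mat (b' (Suc 0)) (b (Suc 0))" "graded_matrix (s' (Suc 0)) (s (Suc 0)) \<phi>'"
    "d' 0 * \<phi>' = \<phi> * d 0"
    using graded_matrix_lift[OF G.diff_carrier G.graded_differential M
        graded_matrix_mult[OF \<phi>(1,2) F.diff_carrier F.graded_differential]] by blast
  with \<phi> show ?thesis
    unfolding lifts_one_step_def by metis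
qed

text \<open>The extension extends further: \<open>\<phi>' * d (i + 1)\<close> maps to the kernel of \<open>d' i\<close>, as \<open>d i * d (i + 1)\<close>
  vanishes, and this kernel is the image of \<open>d' (i + 1)\<close>.\<close>
lemma lifts_one_step_Suc:
  fixes I :: "('v, 'k::field) mpoly set"
  assumes F: "graded_free_resolution I b s a d" and G: "graded_free_resolution I b' s' a' d'"
    and \<phi>: "\<phi> \<in> carrier_mat (b' i) (b i)"
    and \<phi>': "\<phi>' \<in> carrier_mat (b' (Suc i)) (b (Suc i))" "graded_matrix (s' (Suc i)) (s (Suc i)) \<phi>'"
    and comm: "\<phi> * d i = d' i * \<phi>'"
  shows "lifts_one_step b s d b' s' d' (Suc i) \<phi>'"
proof -
  interpret F: graded_free_resolution I b s a d by (rule F)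
  interpret G: graded_free_resolution I b' s' a' d' by (rule G)
  have M: "\<phi>' * d (Suc i) \<in> carrier_mat (b' (Suc i)) (b (Suc (Suc i)))"
    using \<phi>'(1) F.diff_carrier by (rule mult_carrier_mat)
  have "d' i * (\<phi>' * d (Suc i)) = (\<phi> * d i) * d (Suc i)"
    unfolding comm by (rule assoc_mult_mat[symmetric, OF G.diff_carrier \<phi>'(1) F.diff_carrier])
  also have "\<dots> = \<phi> * (d i * d (Suc i))"
    by (rule assoc_mult_mat[OF \<phi> F.diff_carrier F.diff_carrier])
  also have "\<dots> = 0\<^sub>m (b' i) (b (Suc (Suc i)))"
    unfolding F.differential_squared by (rule right_mult_zero_mat[OF \<phi>])
  finally have "d' i * (\<phi>' * d (Suc i)) = 0\<^sub>m (b' i) (b (Suc (Suc i)))" .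
  from G.kernel_lift[OF M this]
  obtain \<phi>'' where "\<phi>'' \<in> carrier_mat (b' (Suc (Suc i))) (b (Suc (Suc i)))"
    "graded_matrix (s' (Suc (Suc i))) (s (Suc (Suc i))) \<phi>''" "d' (Suc i) * \<phi>'' = \<phi>' * d (Suc i)"
    using graded_matrix_lift[OF G.diff_carrier G.graded_differential M
        graded_matrix_mult[OF \<phi>' F.diff_carrier F.graded_differential]] by blast
  with \<phi>' show ?thesis
    unfolding lifts_one_step_def by metis
qed

text \<open>The matrix vanishes modulo the graded maximal ideal.\<close>
definition zero_constant_terms :: "('v, 'k::zero) mpoly mat \<Rightarrow> bool" where
  "zero_constant_terms M \<longleftrightarrow> (\<forall>k<dim_row M. \<forall>j<dim_col M. Poly_Mapping.lookup (M $$ (k, j)) 0 = 0)"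

lemma zero_constant_termsD:
  "zero_constant_terms M \<Longrightarrow> M \<in> carrier_mat p q \<Longrightarrow> i < p \<Longrightarrow> j < q \<Longrightarrow> Poly_Mapping.lookup (M $$ (i, j)) 0 = 0"
  by (auto simp: zero_constant_terms_def)

lemma lookup_sum_mult_zero:
  fixes f g :: "_ \<Rightarrow> ('v, 'k::comm_ring_1) mpoly"
  shows "Poly_Mapping.lookup (\<Sum>l\<in>A. f l * g l) 0 =
    (\<Sum>l\<in>A. Poly_Mapping.lookup (f l) 0 * Poly_Mapping.lookup (g l) 0)"
  by (simp add: lookup_sum lookup_mult_zero)

lemma lookup_mat_mult_zero:
  fixes M N :: "('v, 'k::comm_ring_1) mpoly mat"
  assumes "M \<in> carrier_mat p q" "N \<in> carrier_mat q r" "i < p" "j < r"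
  shows "Poly_Mapping.lookup ((M * N) $$ (i, j)) 0 =
    (\<Sum>l<q. Poly_Mapping.lookup (M $$ (i, l)) 0 * Poly_Mapping.lookup (N $$ (l, j)) 0)"
  using assms by (auto simp: scalar_prod_def atLeast0LessThan lookup_sum_mult_zero)

lemma zero_constant_terms_mult_left:
  fixes M N :: "('v, 'k::comm_ring_1) mpoly mat"
  assumes "M \<in> carrier_mat p q" "N \<in> carrier_mat q r" "zero_constant_terms M"
  shows "zero_constant_terms (M * N)"
  using assms by (auto simp: zero_constant_terms_def lookup_mat_mult_zero simp del: index_mult_mat(1))

lemma zero_constant_terms_mult_right:
  fixes M N :: "('v, 'k::comm_ring_1) mpoly mat"
  assumes "M \<in> carrier_mat p q" "N \<in> carrier_mat q r" "zero_constant_terms N"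
  shows "zero_constant_terms (M * N)"
  using assms by (auto simp: zero_constant_terms_def lookup_mat_mult_zero simp del: index_mult_mat(1))

lemma minimal_zero_constant_terms:
  assumes "minimal_graded_free_resolution I b s a d"
  shows "zero_constant_terms (d i)"
proof -
  interpret minimal_graded_free_resolution I b s a d by (rule assms)
  show ?thesis
    using diff_carrier[of i] minimal by (auto simp: zero_constant_terms_def intro: irrelevant_ideal_constant_coeff)
qed

text \<open>
  The composite \<open>\<psi> * \<phi>\<close> of two comparison maps is homotopic to the identity. Writing \<open>g\<close> for the
  product of the previous homotopy and the differential, the induction only has to remember that
  \<open>g\<close> annihilates the differential and vanishes modulo the maximal ideal. In the step,
  \<open>d i * (\<psi>' * \<phi>' - 1 - h * d i) = g * d i = 0\<close>, so the difference lifts to the next homotopy \<open>h'\<close>, and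
  \<open>h * d i\<close> takes the place of \<open>g\<close>.
\<close>
lemma comparison:
  fixes I :: "('v, 'k::field) mpoly set"
  assumes F: "minimal_graded_free_resolution I b s a d" and G: "graded_free_resolution I b' s' a' d'"
    and I: "homogeneous_ideal I"
  shows "\<exists>\<phi> \<psi> h g. lifts_one_step b s d b' s' d' i \<phi> \<and> lifts_one_step b' s' d' b s d i \<psi> \<and>
    h \<in> carrier_mat (b (Suc i)) (b i) \<and> g \<in> carrier_mat (b i) (b i) \<and>
    g * d i = 0\<^sub>m (b i) (b (Suc i)) \<and> zero_constant_terms g \<and> \<psi> * \<phi> = 1\<^sub>m (b i) + (d i * h + g)"
proof (induction i)
  case 0
  interpret F: minimal_graded_free_resolution I b s a d by (rule F)
  interpret G: graded_free_resolution I b' s' a' d' by (rule G)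
  have F': "graded_free_resolution I b s a d" ..
  have sub: "polynomial_ring.subspace I" by (rule homogeneous_ideal_subspace[OF I])
  obtain \<phi> where \<phi>: "\<phi> \<in> carrier_mat (b' 0) (b 0)" "graded_matrix (s' 0) (s 0) \<phi>"
    "\<And>x. x \<in> carrier_vec (b 0) \<Longrightarrow> a' \<bullet> (\<phi> *\<^sub>v x) - a \<bullet> x \<in> I"
    using augmentation_lift_of_identity[OF F' G I] by blast
  obtain \<psi> where \<psi>: "\<psi> \<in> carrier_mat (b 0) (b' 0)" "graded_matrix (s 0) (s' 0) \<psi>"
    "\<And>x. x \<in> carrier_vec (b' 0) \<Longrightarrow> a \<bullet> (\<psi> *\<^sub>v x) - a' \<bullet> x \<in> I"
    using augmentation_lift_of_identity[OF G F' I] by blast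
  have \<psi>\<phi>: "\<psi> * \<phi> \<in> carrier_mat (b 0) (b 0)" using \<psi>(1) \<phi>(1) by (rule mult_carrier_mat)
  let ?M = "\<psi> * \<phi> - 1\<^sub>m (b 0)"
  have M: "?M \<in> carrier_mat (b 0) (b 0)" by (rule minus_carrier_mat) simp
  have "a \<bullet> col ?M j \<in> I" if j: "j < b 0" for j
  proof -
    have u: "unit_vec (b 0) j \<in> carrier_vec (b 0)" by simp
    have "col (\<psi> * \<phi>) j = \<psi> *\<^sub>v (\<phi> *\<^sub>v unit_vec (b 0) j)"
      using col_mult2[OF \<psi>(1) \<phi>(1) j] mult_unit_vec[OF \<phi>(1) j] by simp
    moreover have "col ?M j = col (\<psi> * \<phi>) j - unit_vec (b 0) j"
      by (rule col_minus_one[OF \<psi>\<phi> j])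
    ultimately have "a \<bullet> col ?M j = a \<bullet> (\<psi> *\<^sub>v (\<phi> *\<^sub>v unit_vec (b 0) j)) - a \<bullet> unit_vec (b 0) j"
      using scalar_prod_minus_distrib[OF F.aug_carrier
          mult_mat_vec_carrier[OF \<psi>(1) mult_mat_vec_carrier[OF \<phi>(1) u]] u] by simp
    also have "\<dots> = (a \<bullet> (\<psi> *\<^sub>v (\<phi> *\<^sub>v unit_vec (b 0) j)) - a' \<bullet> (\<phi> *\<^sub>v unit_vec (b 0) j))
       + (a' \<bullet> (\<phi> *\<^sub>v unit_vec (b 0) j) - a \<bullet> unit_vec (b 0) j)"
      by simp
    also have "\<dots> \<in> I"
      by (intro polynomial_ring.subspace_add[OF sub] \<phi>(3) \<psi>(3) u mult_mat_vec_carrier[OF \<phi>(1)])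
    finally show ?thesis .
  qed
  from F.augmentation_lift[OF M this]
  obtain h where h: "h \<in> carrier_mat (b (Suc 0)) (b 0)" "d 0 * h = ?M"
    using matrix_lift[OF F.diff_carrier M] by blast
  have dh: "d 0 * h \<in> carrier_mat (b 0) (b 0)" using F.diff_carrier h(1) by (rule mult_carrier_mat)
  have "\<psi> * \<phi> = 1\<^sub>m (b 0) + (d 0 * h + 0\<^sub>m (b 0) (b 0))"
    unfolding right_add_zero_mat[OF dh] h(2)
    using add_diff_cancel_mat[OF \<psi>\<phi> one_carrier_mat zero_carrier_mat] \<psi>\<phi> by simp
  moreover have "0\<^sub>m (b 0) (b 0) * d 0 = 0\<^sub>m (b 0) (b (Suc 0))"
    by (rule left_mult_zero_mat[OF F.diff_carrier])
  moreover have "zero_constant_terms (0\<^sub>m (b 0) (b 0) :: ('v, 'k) mpoly mat)"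
    by (simp add: zero_constant_terms_def)
  ultimately show ?case
    using lifts_one_step_0[OF F' G I \<phi>] lifts_one_step_0[OF G F' I \<psi>] h(1)
    by (intro exI[of _ \<phi>] exI[of _ \<psi>] exI[of _ h] exI[of _ "0\<^sub>m (b 0) (b 0)"]) simp
next
  case (Suc i)
  interpret F: minimal_graded_free_resolution I b s a d by (rule F)
  interpret G: graded_free_resolution I b' s' a' d' by (rule G)
  have F': "graded_free_resolution I b s a d" ..
  from Suc obtain \<phi> \<psi> h g where \<phi>: "lifts_one_step b s d b' s' d' i \<phi>"
    and \<psi>: "lifts_one_step b' s' d' b s d i \<psi>"
    and h: "h \<in> carrier_mat (b (Suc i)) (b i)" and g: "g \<in> carrier_mat (b i) (b i)"
    and gd: "g * d i = 0\<^sub>m (b i) (b (Suc i))" and eq: "\<psi> * \<phi> = 1\<^sub>m (b i) + (d i * h + g)"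
    by blast
  from \<phi> obtain \<phi>' where \<phi>c: "\<phi> \<in> carrier_mat (b' i) (b i)"
    and \<phi>': "\<phi>' \<in> carrier_mat (b' (Suc i)) (b (Suc i))" "graded_matrix (s' (Suc i)) (s (Suc i)) \<phi>'"
      "\<phi> * d i = d' i * \<phi>'"
    by (auto simp: lifts_one_step_def)
  from \<psi> obtain \<psi>' where \<psi>c: "\<psi> \<in> carrier_mat (b i) (b' i)"
    and \<psi>': "\<psi>' \<in> carrier_mat (b (Suc i)) (b' (Suc i))" "graded_matrix (s (Suc i)) (s' (Suc i)) \<psi>'"
      "\<psi> * d' i = d i * \<psi>'"
    by (auto simp: lifts_one_step_def)
  note d = F.diff_carrier[of i]
  have hd: "h * d i \<in> carrier_mat (b (Suc i)) (b (Suc i))" using h d by (rule mult_carrier_mat)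
  have dh: "d i * h \<in> carrier_mat (b i) (b i)" using d h by (rule mult_carrier_mat)
  have \<psi>\<phi>: "\<psi>' * \<phi>' \<in> carrier_mat (b (Suc i)) (b (Suc i))"
    using \<psi>'(1) \<phi>'(1) by (rule mult_carrier_mat)
  have "d i * (\<psi>' * \<phi>') = (d i * \<psi>') * \<phi>'"
    by (rule assoc_mult_mat[symmetric, OF d \<psi>'(1) \<phi>'(1)])
  also have "\<dots> = \<psi> * (\<phi> * d i)"
    unfolding \<psi>'(3)[symmetric] \<phi>'(3) by (rule assoc_mult_mat[OF \<psi>c G.diff_carrier \<phi>'(1)])
  also have "\<dots> = (\<psi> * \<phi>) * d i"
    by (rule assoc_mult_mat[symmetric, OF \<psi>c \<phi>c d])
  also have "\<dots> = d i + d i * h * d i"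
  proof -
    have "(\<psi> * \<phi>) * d i = 1\<^sub>m (b i) * d i + (d i * h + g) * d i"
      unfolding eq by (rule add_mult_distrib_mat[OF one_carrier_mat _ d]) (use dh g in auto)
    also have "(d i * h + g) * d i = d i * h * d i + g * d i"
      by (rule add_mult_distrib_mat[OF dh g d])
    finally show ?thesis
      using d dh by (simp add: gd)
  qed
  also have "d i * h * d i = d i * (h * d i)"
    by (rule assoc_mult_mat[OF d h d])
  finally have key: "d i * (\<psi>' * \<phi>') = d i + d i * (h * d i)" .
  let ?M = "\<psi>' * \<phi>' - (1\<^sub>m (b (Suc i)) + h * d i)"
  have sum_c: "1\<^sub>m (b (Suc i)) + h * d i \<in> carrier_mat (b (Suc i)) (b (Suc i))"
    using hd by simp
  have M: "?M \<in> carrier_mat (b (Suc i)) (b (Suc i))"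
    by (rule minus_carrier_mat[OF sum_c])
  have "d i * ?M = d i * (\<psi>' * \<phi>') - d i * (1\<^sub>m (b (Suc i)) + h * d i)"
    by (rule mult_minus_distrib_mat[OF d \<psi>\<phi> sum_c])
  also have "d i * (1\<^sub>m (b (Suc i)) + h * d i) = d i + d i * (h * d i)"
    using d hd by (subst mult_add_distrib_mat[OF d one_carrier_mat hd]) simp
  finally have "d i * ?M = 0\<^sub>m (b i) (b (Suc i))"
    unfolding key using d hd by auto
  from F.kernel_lift[OF M this]
  obtain h' where h': "h' \<in> carrier_mat (b (Suc (Suc i))) (b (Suc i))" "d (Suc i) * h' = ?M"
    using matrix_lift[OF F.diff_carrier M] by blast
  have "\<psi>' * \<phi>' = 1\<^sub>m (b (Suc i)) + (d (Suc i) * h' + h * d i)"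
    unfolding h'(2) by (rule add_diff_cancel_mat[OF \<psi>\<phi> one_carrier_mat hd])
  moreover have "(h * d i) * d (Suc i) = 0\<^sub>m (b (Suc i)) (b (Suc (Suc i)))"
    unfolding assoc_mult_mat[OF h d F.diff_carrier] F.differential_squared
    by (rule right_mult_zero_mat[OF h])
  moreover have "zero_constant_terms (h * d i)"
    by (rule zero_constant_terms_mult_right[OF h d minimal_zero_constant_terms[OF F]])
  ultimately show ?case
    using lifts_one_step_Suc[OF F' G \<phi>c \<phi>'] lifts_one_step_Suc[OF G F' \<psi>c \<psi>'] h'(1) hd
    by (intro exI[of _ \<phi>'] exI[of _ \<psi>'] exI[of _ h'] exI[of _ "h * d i"]) simp
qed

text \<open>Modulo the maximal ideal, \<open>comparison\<close> says that the scalar matrix of \<open>\<psi>\<close> is a left inverse of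
  that of \<open>\<phi>\<close>. Both respect degrees, so this remains true for the blocks of the degrees in \<open>E\<close>. A
  singleton \<open>E\<close> gives graded ranks, and \<open>UNIV\<close> gives total ranks.\<close>
lemma graded_rank_le:
  fixes I :: "('v, 'k::field) mpoly set"
  assumes F: "minimal_graded_free_resolution I b s a d" and G: "graded_free_resolution I b' s' a' d'"
    and I: "homogeneous_ideal I"
  shows "card {j. j < b r \<and> s r j \<in> E} \<le> card {j. j < b' r \<and> s' r j \<in> E}"
proof -
  interpret F: minimal_graded_free_resolution I b s a d by (rule F)
  obtain \<phi> \<psi> h g where \<phi>: "lifts_one_step b s d b' s' d' r \<phi>"
    and \<psi>: "lifts_one_step b' s' d' b s d r \<psi>"
    and h: "h \<in> carrier_mat (b (Suc r)) (b r)" and g: "g \<in> carrier_mat (b r) (b r)" "zero_constant_terms g"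
    and eq: "\<psi> * \<phi> = 1\<^sub>m (b r) + (d r * h + g)"
    using comparison[OF F G I, of r] by blast
  from \<phi> have \<phi>: "\<phi> \<in> carrier_mat (b' r) (b r)" "graded_matrix (s' r) (s r) \<phi>"
    by (auto simp: lifts_one_step_def)
  from \<psi> have \<psi>: "\<psi> \<in> carrier_mat (b r) (b' r)"
    by (auto simp: lifts_one_step_def)
  define A where "A k j = Poly_Mapping.lookup (\<phi> $$ (k, j)) 0" for k j
  define B where "B i k = Poly_Mapping.lookup (\<psi> $$ (i, k)) 0" for i k
  have dh: "zero_constant_terms (d r * h)" "d r * h \<in> carrier_mat (b r) (b r)"
    using zero_constant_terms_mult_left[OF F.diff_carrier h minimal_zero_constant_terms[OF F]]
      mult_carrier_mat[OF F.diff_carrier h] by auto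
  have BA: "(\<Sum>k<b' r. B i k * A k j) = (if i = j then 1 else 0)" if "i < b r" "j < b r" for i j
  proof -
    have "(\<Sum>k<b' r. B i k * A k j) = Poly_Mapping.lookup ((\<psi> * \<phi>) $$ (i, j)) 0"
      unfolding A_def B_def lookup_mat_mult_zero[OF \<psi> \<phi>(1) that] ..
    also have "\<dots> = Poly_Mapping.lookup (1\<^sub>m (b r) $$ (i, j) :: ('v, 'k) mpoly) 0"
      unfolding eq using that dh g zero_constant_termsD[OF dh that] zero_constant_termsD[OF g(2,1) that]
      by (simp add: lookup_add del: index_mult_mat(1) index_one_mat(1))
    also have "\<dots> = (if i = j then 1 else 0)"
      using that by (simp add: lookup_one)
    finally show ?thesis .
  qed
  have A0: "A k j = 0" if "k < b' r" "j < b r" "s' r k \<noteq> s r j" for k j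
    unfolding A_def using \<phi> that
    by (intro homogeneous_constant_coeff[of "s r j - s' r k"]) (auto simp: graded_matrix_def)
  show ?thesis
  proof (rule card_le_of_left_inverse[where A = A and B = B])
    fix i j assume ij: "i \<in> {j. j < b r \<and> s r j \<in> E}" "j \<in> {j. j < b r \<and> s r j \<in> E}"
    have "(\<Sum>k\<in>{k. k < b' r \<and> s' r k \<in> E}. B i k * A k j) = (\<Sum>k<b' r. B i k * A k j)"
    proof (rule sum.mono_neutral_left)
      show "\<forall>k\<in>{..<b' r} - {k. k < b' r \<and> s' r k \<in> E}. B i k * A k j = 0"
        using ij A0 by fastforce
    qed auto
    then show "(\<Sum>k\<in>{k. k < b' r \<and> s' r k \<in> E}. B i k * A k j) = (if i = j then 1 else 0)"
      using BA ij by simp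
  qed auto
qed

lemma graded_rank_unique:
  fixes I :: "('v, 'k::field) mpoly set"
  assumes F: "minimal_graded_free_resolution I b s a d" and G: "minimal_graded_free_resolution I b' s' a' d'"
    and I: "homogeneous_ideal I"
  shows "card {j. j < b r \<and> s r j \<in> E} = card {j. j < b' r \<and> s' r j \<in> E}"
  using graded_rank_le[OF F minimal_graded_free_resolution.axioms(1)[OF G] I]
    graded_rank_le[OF G minimal_graded_free_resolution.axioms(1)[OF F] I]
  by (simp add: le_antisym)

lemma graded_betti_quot_eq:
  assumes F: "minimal_graded_free_resolution I b s a d" and I: "homogeneous_ideal I"
  shows "graded_betti_quot I r e = card {j. j < b r \<and> s r j = e}"
  unfolding graded_betti_quot_def
proof (rule the_equality)
  show "\<exists>b' s' a d. minimal_graded_free_resolution I b' s' a d \<and>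
    card {j. j < b r \<and> s r j = e} = card {j. j < b' r \<and> s' r j = e}"
    using F by blast
next
  fix n assume "\<exists>b' s' a d. minimal_graded_free_resolution I b' s' a d \<and> n = card {j. j < b' r \<and> s' r j = e}"
  then show "n = card {j. j < b r \<and> s r j = e}"
    using graded_rank_unique[OF F _ I, where E = "{e}"] by auto
qed

lemma betti_quot_eq:
  assumes F: "minimal_graded_free_resolution I b s a d" and I: "homogeneous_ideal I"
  shows "betti_quot I r = b r"
  unfolding betti_quot_def
proof (rule the_equality)
  show "\<exists>b' s' a d. minimal_graded_free_resolution I b' s' a d \<and> b r = b' r"
    using F by blast
next
  fix n assume "\<exists>b' s' a d. minimal_graded_free_resolution I b' s' a d \<and> n = b' r"
  then show "n = b r"
    using graded_rank_unique[OF F _ I, where E = UNIV] by auto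
qed

section \<open>Frames of resolutions\<close>

text \<open>
  A complex of vector spaces with labelled bases that is exact below every label, except in
  homological degree 0 below the empty label. It is the common pattern of the minimal multigraded
  resolutions of all monomial ideals with the same lcm-lattice \<open>\<T>\<close>.
  The scalar \<open>C i k j\<close> is the entry of the \<open>i\<close>-th differential in row \<open>k\<close> and column \<open>j\<close>. The strict
  inclusion in \<open>strict\<close> expresses minimality: entries between basis vectors with the same label, which
  would become units of the polynomial ring, are zero. The condition \<open>augmented\<close> says that \<open>R/I\<close>
  vanishes in the multidegrees that are divisible by a generator.
\<close>
locale resolution_frame =
  fixes \<T> :: "'i set set" and b :: "nat \<Rightarrow> nat" and \<mu> :: "nat \<Rightarrow> nat \<Rightarrow> 'i set"
    and C :: "nat \<Rightarrow> nat \<Rightarrow> nat \<Rightarrow> 'k::field"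
  assumes rank_0: "b 0 = 1"
    and label_0: "\<mu> 0 0 = {}"
    and label: "j < b i \<Longrightarrow> \<mu> i j \<in> \<T>"
    and strict: "k < b i \<Longrightarrow> j < b (Suc i) \<Longrightarrow> C i k j \<noteq> 0 \<Longrightarrow> \<mu> i k \<subset> \<mu> (Suc i) j"
    and augmented: "T \<in> \<T> \<Longrightarrow> T \<noteq> {} \<Longrightarrow>
      \<exists>c. supported (b 1) (\<mu> 1) T c \<and> (\<Sum>j<b 1. C 0 0 j * c j) = 1"
    and complex: "k < b i \<Longrightarrow> l < b (Suc (Suc i)) \<Longrightarrow> (\<Sum>j<b (Suc i). C i k j * C (Suc i) j l) = 0"
    and exact: "T \<in> \<T> \<Longrightarrow> supported (b (Suc i)) (\<mu> (Suc i)) T c \<Longrightarrow>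
      (\<And>k. k < b i \<Longrightarrow> (\<Sum>j<b (Suc i). C i k j * c j) = 0) \<Longrightarrow>
      \<exists>c'. supported (b (Suc (Suc i))) (\<mu> (Suc (Suc i))) T c' \<and>
        (\<forall>j<b (Suc i). c j = (\<Sum>l<b (Suc (Suc i)). C (Suc i) j l * c' l))"

text \<open>The state of the construction (a rank, labels and generators) is packed into a triple, as
  dependent choice requires.\<close>
definition relations :: "nat \<times> (nat \<Rightarrow> 'l::order) \<times> (nat \<Rightarrow> 'a \<Rightarrow> 'k::field) \<Rightarrow> 'l \<Rightarrow> (nat \<Rightarrow> 'k) set" where
  "relations = (\<lambda>(b, \<mu>, g) T. {c. supported b \<mu> T c \<and> (\<forall>k. (\<Sum>j<b. c j * g j k) = 0)})"

lemma relations_generators_exist: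
  fixes \<T> :: "'l::order set" and x :: "nat \<times> (nat \<Rightarrow> 'l) \<times> (nat \<Rightarrow> 'a \<Rightarrow> 'k::field)"
  assumes "finite \<T>"
  shows "\<exists>b \<mu> g. minimal_generators \<T> (relations x) b \<mu> g"
proof -
  obtain b \<mu> g where x: "x = (b, \<mu>, g)" by (cases x)
  have sub: "coordinate_space.subspace (relations x T)" for T
  proof (rule coordinate_space.subspaceI)
    show "0 \<in> relations x T" by (simp add: x relations_def supported_def)
  next
    fix c e assume "c \<in> relations x T" "e \<in> relations x T"
    then show "c + e \<in> relations x T"
      by (auto simp: x relations_def supported_def algebra_simps sum.distrib) (metis add.right_neutral)+
  next
    fix r c assume "c \<in> relations x T"
    then show "(\<lambda>i. r * c i) \<in> relations x T"
      by (auto simp: x relations_def supported_def mult.assoc sum_distrib_left[symmetric])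
  qed
  have span: "relations x T \<subseteq> coordinate_space.span ((\<lambda>i k. if k = i then 1 else 0) ` {..<b})" for T
    by (auto simp: x relations_def supported_def intro!: finite_support_in_span)
  have mono: "relations x S \<subseteq> relations x T" if "S \<le> T" for S T
    using that by (auto simp: x relations_def intro: supported_mono)
  obtain b' \<mu>' g' where "minimal_generators \<T> (relations x) b' \<mu>' g'"
    by (rule minimal_generators_exist[OF assms sub _ span mono]) auto
  then show ?thesis by blast
qed

text \<open>The strands of the ideal inside the strands of the polynomial ring: one-dimensional in every
  nonempty label, zero in the empty one. The single coordinate has the index 0.\<close>
definition augmentation_kernel :: "'i set \<Rightarrow> (nat \<Rightarrow> 'k::field) set" where
  "augmentation_kernel T = {c. (\<forall>k. c k \<noteq> 0 \<longrightarrow> k = 0) \<and> (T = {} \<longrightarrow> c 0 = 0)}"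

lemma initial_generators_exist:
  fixes \<T> :: "'i set set"
  assumes "finite \<T>"
  shows "\<exists>b \<mu> g. minimal_generators \<T> (augmentation_kernel :: _ \<Rightarrow> (nat \<Rightarrow> 'k::field) set) b \<mu> g"
proof -
  let ?K = "augmentation_kernel :: 'i set \<Rightarrow> (nat \<Rightarrow> 'k) set"
  have sub: "coordinate_space.subspace (?K T)" for T
  proof (rule coordinate_space.subspaceI)
    show "c + e \<in> ?K T" if "c \<in> ?K T" "e \<in> ?K T" for c e
    proof -
      have "c k = 0 \<and> e k = 0" if "k \<noteq> 0" for k
        using that \<open>c \<in> ?K T\<close> \<open>e \<in> ?K T\<close> by (auto simp: augmentation_kernel_def)
      then show ?thesis
        using that by (auto simp: augmentation_kernel_def)
    qed
  qed (auto simp: augmentation_kernel_def)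
  have span: "?K T \<subseteq> coordinate_space.span ((\<lambda>i k. if k = i then 1 else 0) ` {0})" for T
    by (intro subsetI finite_support_in_span) (auto simp: augmentation_kernel_def)
  have mono: "?K S \<subseteq> ?K T" if "S \<subseteq> T" for S T
    using that by (auto simp: augmentation_kernel_def)
  obtain b \<mu> g where "minimal_generators \<T> ?K b \<mu> g"
    by (rule minimal_generators_exist[OF assms sub _ span mono]) auto
  then show ?thesis by blast
qed

text \<open>Starting with minimal generators of \<open>augmentation_kernel\<close>, each step takes minimal
  generators of the relations between the previous ones. By minimality in the previous step, a
  relation with label \<open>T\<close> does not involve generators with the same label, which yields \<open>strict\<close>.\<close>
theorem resolution_frame_exists:
  fixes \<T> :: "'i set set"
  assumes fin: "finite \<T>" and empty: "{} \<in> \<T>"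
  shows "\<exists>b \<mu> (C :: nat \<Rightarrow> nat \<Rightarrow> nat \<Rightarrow> 'k::field). resolution_frame \<T> b \<mu> C"
proof -
  let ?K0 = "augmentation_kernel :: 'i set \<Rightarrow> (nat \<Rightarrow> 'k) set"
  define gens where "gens K x = (case x of (b, \<mu>, g) \<Rightarrow> minimal_generators \<T> K b \<mu> g)"
    for K :: "'i set \<Rightarrow> (nat \<Rightarrow> 'k) set" and x :: "nat \<times> (nat \<Rightarrow> 'i set) \<times> (nat \<Rightarrow> nat \<Rightarrow> 'k)"
  have "\<exists>f. \<forall>n. (n = 0 \<longrightarrow> gens ?K0 (f n)) \<and> gens (relations (f n)) (f (Suc n))"
  proof (rule dependent_nat_choice)
    show "\<exists>x. (0::nat) = 0 \<longrightarrow> gens ?K0 x"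
      using initial_generators_exist[OF fin, where ?'k = 'k] by (auto simp: gens_def)
  next
    fix x and n :: nat
    show "\<exists>y. (Suc n = 0 \<longrightarrow> gens ?K0 y) \<and> gens (relations x) y"
      using relations_generators_exist[OF fin, of x] by (auto simp: gens_def)
  qed
  then obtain f where f: "gens ?K0 (f 0)" "\<And>n. gens (relations (f n)) (f (Suc n))"
    by metis
  \<comment> \<open>The generators chosen in step \<open>n\<close> are the basis in homological degree \<open>n + 1\<close>; degree 0 is the
    polynomial ring itself.\<close>
  define b where "b i = (case i of 0 \<Rightarrow> 1 | Suc n \<Rightarrow> fst (f n))" for i
  define \<mu> where "\<mu> i = (case i of 0 \<Rightarrow> \<lambda>_. {} | Suc n \<Rightarrow> fst (snd (f n)))" for i
  define C where "C i k j = snd (snd (f i)) j k" for i k j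
  have f_eq: "f i = (b (Suc i), \<mu> (Suc i), \<lambda>j k. C i k j)" for i
    by (simp add: b_def \<mu>_def C_def)
  define K where "K i = (case i of 0 \<Rightarrow> ?K0 | Suc n \<Rightarrow> relations (f n))" for i
  have "gens (K i) (f i)" for i
    using f by (cases i) (simp_all add: K_def)
  then have gen: "minimal_generators \<T> (K i) (b (Suc i)) (\<mu> (Suc i)) (\<lambda>j k. C i k j)" for i
    unfolding f_eq gens_def by simp
  have lab: "\<mu> (Suc i) j \<in> \<T>" and in_K: "(\<lambda>k. C i k j) \<in> K i (\<mu> (Suc i) j)" if "j < b (Suc i)" for i j
    using gen[of i] that by (auto simp: minimal_generators_def)
  have generate: "\<exists>c. supported (b (Suc i)) (\<mu> (Suc i)) T c \<and> (\<forall>k. x k = (\<Sum>j<b (Suc i). c j * C i k j))"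
    if "T \<in> \<T>" "x \<in> K i T" for i T x
    using gen[of i] that by (simp add: minimal_generators_def)
  have K_Suc: "K (Suc i) T = {c. supported (b (Suc i)) (\<mu> (Suc i)) T c \<and> (\<forall>k. (\<Sum>j<b (Suc i). c j * C i k j) = 0)}"
    for i T
    by (simp add: K_def f_eq relations_def)
  have entry: "k < b i \<and> \<mu> i k \<subset> \<mu> (Suc i) j" if j: "j < b (Suc i)" and nz: "C i k j \<noteq> 0" for i k j
  proof (cases i)
    case 0
    then show ?thesis
      using in_K[OF j] nz by (auto simp: K_def augmentation_kernel_def b_def \<mu>_def)
  next
    case (Suc n)
    have c: "supported (b i) (\<mu> i) (\<mu> (Suc i) j) (\<lambda>k. C i k j)"
      "\<forall>k. (\<Sum>l<b i. C i l j * C n k l) = 0"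
      using in_K[OF j] by (auto simp: Suc K_Suc)
    have "\<mu> i k \<noteq> \<mu> (Suc i) j"
    proof
      assume "\<mu> i k = \<mu> (Suc i) j"
      then have "C i k j = 0"
        using gen[of n, unfolded minimal_generators_def, THEN conjunct2, THEN conjunct2,
            rule_format, OF lab[OF j], of "\<lambda>k. C i k j" k] c by (simp add: Suc)
      with nz show False by simp
    qed
    then show ?thesis
      using c(1) nz by (auto simp: supported_def)
  qed
  have "resolution_frame \<T> b \<mu> C"
  proof
    show "b 0 = 1" "\<mu> 0 0 = {}" by (simp_all add: b_def \<mu>_def)
  next
    fix i j assume "j < b i"
    then show "\<mu> i j \<in> \<T>"
      using lab empty by (cases i) (auto simp: \<mu>_def[of 0])
  next
    fix i j k assume "k < b i" "j < b (Suc i)" "C i k j \<noteq> 0"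
    then show "\<mu> i k \<subset> \<mu> (Suc i) j" using entry by blast
  next
    fix T assume T: "T \<in> \<T>" "T \<noteq> {}"
    then have "(\<lambda>k. if k = 0 then 1 else 0) \<in> K 0 T"
      by (auto simp: K_def augmentation_kernel_def)
    from generate[OF T(1) this] obtain c where c: "supported (b (Suc 0)) (\<mu> (Suc 0)) T c"
      "\<forall>k. (if k = 0 then 1 else 0) = (\<Sum>j<b (Suc 0). c j * C 0 k j)" by blast
    from c(2)[rule_format, of 0] have "(\<Sum>j<b 1. C 0 0 j * c j) = 1"
      by (simp add: mult.commute)
    with c(1) show "\<exists>c. supported (b 1) (\<mu> 1) T c \<and> (\<Sum>j<b 1. C 0 0 j * c j) = 1"
      by auto
  next
    fix i k l assume "k < b i" "l < b (Suc (Suc i))"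
    then show "(\<Sum>j<b (Suc i). C i k j * C (Suc i) j l) = 0"
      using in_K[of l "Suc i"] by (auto simp: K_Suc mult.commute)
  next
    fix T i c
    assume T: "T \<in> \<T>" and c: "supported (b (Suc i)) (\<mu> (Suc i)) T c"
      and 0: "\<And>k. k < b i \<Longrightarrow> (\<Sum>j<b (Suc i). C i k j * c j) = 0"
    have "(\<Sum>j<b (Suc i). c j * C i k j) = 0" for k
    proof (cases "k < b i")
      case True
      then show ?thesis using 0[of k] by (simp add: mult.commute)
    next
      case False
      then have "C i k j = 0" if "j < b (Suc i)" for j
        using entry[OF that] by blast
      then show ?thesis by simp
    qed
    then have "c \<in> K (Suc i) T" using c by (simp add: K_Suc)
    from generate[OF T this] obtain c' where "supported (b (Suc (Suc i))) (\<mu> (Suc (Suc i))) T c'"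
      "\<forall>j. c j = (\<Sum>l<b (Suc (Suc i)). c' l * C (Suc i) j l)" by blast
    then show "\<exists>c'. supported (b (Suc (Suc i))) (\<mu> (Suc (Suc i))) T c' \<and>
        (\<forall>j<b (Suc i). c j = (\<Sum>l<b (Suc (Suc i)). C (Suc i) j l * c' l))"
      by (auto simp: mult.commute)
  qed
  then show ?thesis by blast
qed

section \<open>From frames to resolutions of monomial ideals\<close>

definition lcm_monom :: "('i \<Rightarrow> ('v::finite \<Rightarrow>\<^sub>0 nat)) \<Rightarrow> 'i set \<Rightarrow> ('v \<Rightarrow>\<^sub>0 nat)" where
  "lcm_monom m T = Abs_poly_mapping (\<lambda>v. Max (insert 0 ((\<lambda>k. Poly_Mapping.lookup (m k) v) ` T)))"

lemma lookup_lcm_monom: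
  "Poly_Mapping.lookup (lcm_monom m T) v = Max (insert 0 ((\<lambda>k. Poly_Mapping.lookup (m k) v) ` T))"
  by (simp add: lcm_monom_def)

lemma lcm_monom_divides_iff:
  assumes "finite T"
  shows "lcm_monom m T divides t \<longleftrightarrow> (\<forall>k\<in>T. m k divides t)"
proof -
  have "Max (insert 0 ((\<lambda>k. Poly_Mapping.lookup (m k) v) ` T)) \<le> n \<longleftrightarrow>
    (\<forall>k\<in>T. Poly_Mapping.lookup (m k) v \<le> n)" for v n
    by (subst Max_le_iff) (use assms in auto)
  then show ?thesis
    unfolding divides_def lookup_lcm_monom by blast
qed

lemma lcm_monom_empty [simp]: "lcm_monom m {} = 0"
  by (rule poly_mapping_eqI) (simp add: lookup_lcm_monom)

definition monomial_ideal :: "('i \<Rightarrow> ('v \<Rightarrow>\<^sub>0 nat)) \<Rightarrow> 'i set \<Rightarrow> ('v, 'k::comm_ring_1) mpoly set" where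
  "monomial_ideal m A = polynomial_ring.span ((\<lambda>k. Poly_Mapping.single (m k) 1) ` A)"

lemma homogeneous_monomial_ideal: "homogeneous_ideal (monomial_ideal m A)"
proof -
  have "homogeneous (int (monom_degree (m k))) (Poly_Mapping.single (m k) 1)" for k
    by (auto simp: homogeneous_def split: if_splits)
  then show ?thesis
    unfolding homogeneous_ideal_def monomial_ideal_def
    by (intro exI[of _ "(\<lambda>k. Poly_Mapping.single (m k) 1) ` A"]) auto
qed

lemma monomial_ideal_iff:
  fixes p :: "('v, 'k::comm_ring_1) mpoly"
  shows "p \<in> monomial_ideal m A \<longleftrightarrow> (\<forall>t. Poly_Mapping.lookup p t \<noteq> 0 \<longrightarrow> (\<exists>k\<in>A. m k divides t))"
proof
  assume "p \<in> monomial_ideal m A"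
  then show "\<forall>t. Poly_Mapping.lookup p t \<noteq> 0 \<longrightarrow> (\<exists>k\<in>A. m k divides t)"
    unfolding monomial_ideal_def
  proof (induction rule: polynomial_ring.span_induct_alt)
    case (step c x y)
    from step(1) obtain k where k: "k \<in> A" "x = Poly_Mapping.single (m k) 1" by auto
    have "\<exists>k\<in>A. m k divides t" if "Poly_Mapping.lookup (c * x + y) t \<noteq> 0" for t
    proof (cases "Poly_Mapping.lookup y t = 0")
      case True
      then have "Poly_Mapping.lookup (Poly_Mapping.single (m k) 1 * c) t \<noteq> 0"
        using that by (simp add: lookup_add k(2) mult.commute)
      then show ?thesis
        using k(1) by (auto simp: lookup_single_mult split: if_splits)
    qed (use step in blast)
    then show ?case by blast
  qed simp
next
  assume *: "\<forall>t. Poly_Mapping.lookup p t \<noteq> 0 \<longrightarrow> (\<exists>k\<in>A. m k divides t)"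
  have "(\<Sum>t\<in>Poly_Mapping.keys p. Poly_Mapping.single t (Poly_Mapping.lookup p t)) \<in> monomial_ideal m A"
    unfolding monomial_ideal_def
  proof (rule polynomial_ring.span_sum)
    fix t assume "t \<in> Poly_Mapping.keys p"
    then obtain k where k: "k \<in> A" "m k divides t" using * by (auto simp: in_keys_iff)
    have "Poly_Mapping.single t (Poly_Mapping.lookup p t) =
      Poly_Mapping.single (t - m k) (Poly_Mapping.lookup p t) * Poly_Mapping.single (m k) 1"
      using divides_add_diff[OF k(2)] by (simp add: mult_single add.commute)
    then show "Poly_Mapping.single t (Poly_Mapping.lookup p t) \<in>
      polynomial_ring.span ((\<lambda>k. Poly_Mapping.single (m k) 1) ` A)"
      using k(1) by (simp add: polynomial_ring.span_base polynomial_ring.span_scale)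
  qed
  then show "p \<in> monomial_ideal m A"
    by (metis polynomial_sum_single)
qed

text \<open>Mapping a closed set to its least common multiple is an isomorphism onto the lcm-lattice. Working
  with the sets of indices makes the lattices of different ideals comparable by equality.\<close>
definition closed_sets :: "('i \<Rightarrow> ('v::finite \<Rightarrow>\<^sub>0 nat)) \<Rightarrow> 'i set \<Rightarrow> 'i set set" where
  "closed_sets m A = {T. T \<subseteq> A \<and> (\<forall>k\<in>A. m k divides lcm_monom m T \<longrightarrow> k \<in> T)}"

definition divisors :: "('i \<Rightarrow> ('v \<Rightarrow>\<^sub>0 nat)) \<Rightarrow> 'i set \<Rightarrow> ('v \<Rightarrow>\<^sub>0 nat) \<Rightarrow> 'i set" where
  "divisors m A t = {k\<in>A. m k divides t}"

lemma divisors_closed: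
  assumes "finite A"
  shows "divisors m A t \<in> closed_sets m A"
proof -
  have "lcm_monom m (divisors m A t) divides t"
    using assms by (auto simp: lcm_monom_divides_iff divisors_def)
  then show ?thesis
    by (auto simp: closed_sets_def divisors_def intro: divides_trans)
qed

lemma lcm_monom_divides_divisors:
  assumes "finite A" "T \<subseteq> A"
  shows "lcm_monom m T divides t \<longleftrightarrow> T \<subseteq> divisors m A t"
  using assms finite_subset[OF assms(2,1)] by (auto simp: lcm_monom_divides_iff divisors_def)

text \<open>A closed set can be recovered from its least common multiple, so a strictly larger closed
  set has a strictly larger one. Therefore the entries of the differentials below are scalar multiples
  of nonconstant monomials.\<close>
lemma lcm_monom_strict:
  assumes "finite A" "S \<in> closed_sets m A" "T \<in> closed_sets m A" "S \<subset> T"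
  shows "lcm_monom m S divides lcm_monom m T" "lcm_monom m T - lcm_monom m S \<noteq> 0"
proof -
  have fin: "finite S" "finite T"
    using assms finite_subset unfolding closed_sets_def by blast+
  have T: "\<forall>k\<in>T. m k divides lcm_monom m T"
    using lcm_monom_divides_iff[OF fin(2), of m "lcm_monom m T"] by simp
  then show dvd: "lcm_monom m S divides lcm_monom m T"
    using assms(4) by (auto simp: lcm_monom_divides_iff[OF fin(1)])
  obtain k where k: "k \<in> T" "k \<notin> S" using assms(4) by blast
  show "lcm_monom m T - lcm_monom m S \<noteq> 0"
  proof
    assume "lcm_monom m T - lcm_monom m S = 0"
    then have "lcm_monom m T = lcm_monom m S"
      using divides_add_diff[OF dvd] by simp
    then show False
      using T k assms(2,3) unfolding closed_sets_def by auto
  qed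
qed

text \<open>A frame labelled by the closed sets becomes a complex of free modules over the polynomial ring
  when the scalar \<open>C i k j\<close> is multiplied by the monomial that makes the entry multihomogeneous.\<close>
locale monomial_frame = resolution_frame "closed_sets m A" b \<mu> C
  for m :: "'i \<Rightarrow> ('v::finite \<Rightarrow>\<^sub>0 nat)" and A :: "'i set" and b \<mu> and C :: "nat \<Rightarrow> nat \<Rightarrow> nat \<Rightarrow> 'k::field" +
  assumes finite_A: "finite A"
begin

definition shift :: "nat \<Rightarrow> nat \<Rightarrow> ('v \<Rightarrow>\<^sub>0 nat)" where
  "shift i j = lcm_monom m (\<mu> i j)"

definition differential :: "nat \<Rightarrow> ('v, 'k) mpoly mat" where
  "differential i = mat (b i) (b (Suc i)) (\<lambda>(k, j). Poly_Mapping.single (shift (Suc i) j - shift i k) (C i k j))"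

text \<open>The component of multidegree \<open>t\<close> of \<open>c\<close>, in coordinates: the \<open>j\<close>-th basis vector has the
  multidegree \<open>shift i j\<close>, so its multiples of multidegree \<open>t\<close> are those by \<open>t - shift i j\<close>.\<close>
definition strand :: "nat \<Rightarrow> ('v \<Rightarrow>\<^sub>0 nat) \<Rightarrow> ('v, 'k) mpoly vec \<Rightarrow> nat \<Rightarrow> 'k" where
  "strand i t c j = (if j < b i \<and> shift i j divides t then Poly_Mapping.lookup (c $ j) (t - shift i j) else 0)"

lemma differential_carrier: "differential i \<in> carrier_mat (b i) (b (Suc i))"
  by (simp add: differential_def)

lemma shift_divides_iff: "j < b i \<Longrightarrow> shift i j divides t \<longleftrightarrow> \<mu> i j \<subseteq> divisors m A t"
  unfolding shift_def using label[of j i]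
  by (intro lcm_monom_divides_divisors finite_A) (auto simp: closed_sets_def)

lemma supported_iff:
  "supported (b i) (\<mu> i) (divisors m A t) y \<longleftrightarrow> (\<forall>j. y j \<noteq> 0 \<longrightarrow> j < b i \<and> shift i j divides t)"
  using shift_divides_iff by (auto simp: supported_def)

lemma strand_supported: "supported (b i) (\<mu> i) (divisors m A t) (strand i t c)"
  by (auto simp: supported_iff strand_def)

lemma shift_0: "shift 0 0 = 0"
  by (simp add: shift_def label_0)

lemma shift_strict:
  assumes "k < b i" "j < b (Suc i)" "C i k j \<noteq> 0"
  shows "shift i k divides shift (Suc i) j" "shift (Suc i) j - shift i k \<noteq> 0"
  using lcm_monom_strict[OF finite_A label[OF assms(1)] label[OF assms(2)] strict[OF assms]]
  by (simp_all add: shift_def)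

text \<open>On every strand the differential is the scalar matrix of the frame, whatever the multidegree.\<close>
lemma strand_differential:
  assumes c: "c \<in> carrier_vec (b (Suc i))" and k: "k < b i"
  shows "strand i t (differential i *\<^sub>v c) k = (\<Sum>j<b (Suc i). C i k j * strand (Suc i) t c j)"
proof -
  have "(differential i *\<^sub>v c) $ k = (\<Sum>j<b (Suc i). Poly_Mapping.single (shift (Suc i) j - shift i k) (C i k j) * c $ j)"
    using c k by (simp add: differential_def scalar_prod_def atLeast0LessThan)
  then have "strand i t (differential i *\<^sub>v c) k = (\<Sum>j<b (Suc i). if shift i k divides t then
    Poly_Mapping.lookup (Poly_Mapping.single (shift (Suc i) j - shift i k) (C i k j) * c $ j) (t - shift i k) else 0)"
    using k by (simp add: strand_def lookup_sum)
  also have "\<dots> = (\<Sum>j<b (Suc i). C i k j * strand (Suc i) t c j)"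
  proof (intro sum.cong refl)
    fix j assume "j \<in> {..<b (Suc i)}"
    then have j: "j < b (Suc i)" by simp
    show "(if shift i k divides t then Poly_Mapping.lookup
        (Poly_Mapping.single (shift (Suc i) j - shift i k) (C i k j) * c $ j) (t - shift i k) else 0) =
      C i k j * strand (Suc i) t c j"
    proof (cases "C i k j = 0")
      case False
      note kj = shift_strict(1)[OF k j False]
      have eq: "shift i k divides t \<and> shift (Suc i) j - shift i k divides t - shift i k \<longleftrightarrow> shift (Suc i) j divides t"
        using kj unfolding divides_def lookup_minus
        by (metis diff_le_mono eq_diff_iff le_diff_iff le_trans)
      have "t - shift i k - (shift (Suc i) j - shift i k) = t - shift (Suc i) j"
        using kj by (intro poly_mapping_eqI) (simp add: divides_def lookup_minus)
      then show ?thesis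
        using eq j by (auto simp: lookup_single_mult strand_def)
    qed simp
  qed
  finally show ?thesis .
qed

lemma strand_eqI:
  assumes "c \<in> carrier_vec (b i)" "c' \<in> carrier_vec (b i)"
    and eq: "\<And>t j. j < b i \<Longrightarrow> strand i t c j = strand i t c' j"
  shows "c = c'"
proof (rule eq_vecI)
  fix j assume "j < dim_vec c'"
  then have j: "j < b i" using assms(2) by simp
  show "c $ j = c' $ j"
  proof (rule poly_mapping_eqI)
    fix u
    have "shift i j divides u + shift i j" "u + shift i j - shift i j = u"
      by (auto simp: divides_def lookup_add)
    then show "Poly_Mapping.lookup (c $ j) u = Poly_Mapping.lookup (c' $ j) u"
      using eq[OF j, of "u + shift i j"] j by (simp add: strand_def)
  qed
qed (use assms in auto)

lemma finite_strands:
  assumes "c \<in> carrier_vec (b i)"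
  shows "finite {t. strand i t c \<noteq> (\<lambda>_. 0)}"
proof (rule finite_subset)
  show "{t. strand i t c \<noteq> (\<lambda>_. 0)} \<subseteq> (\<Union>j<b i. (\<lambda>u. shift i j + u) ` Poly_Mapping.keys (c $ j))"
  proof
    fix t assume "t \<in> {t. strand i t c \<noteq> (\<lambda>_. 0)}"
    then obtain j where j: "j < b i" "shift i j divides t" "Poly_Mapping.lookup (c $ j) (t - shift i j) \<noteq> 0"
      by (auto simp: strand_def fun_eq_iff split: if_splits)
    have "t = shift i j + (t - shift i j)" using divides_add_diff[OF j(2)] by simp
    then show "t \<in> (\<Union>j<b i. (\<lambda>u. shift i j + u) ` Poly_Mapping.keys (c $ j))"
      using j by (auto simp: in_keys_iff intro!: bexI[of _ j] image_eqI[of _ _ "t - shift i j"])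
  qed
qed simp

lemma strands_assemble:
  assumes fin: "finite {t. y t \<noteq> (\<lambda>_. 0)}"
    and y: "\<And>t. supported (b i) (\<mu> i) (divisors m A t) (y t)"
  shows "\<exists>c\<in>carrier_vec (b i). \<forall>t. strand i t c = y t"
proof -
  let ?Z = "{t. y t \<noteq> (\<lambda>_. 0)}"
  define c where "c = vec (b i) (\<lambda>j. \<Sum>t\<in>?Z. Poly_Mapping.single (t - shift i j) (y t j))"
  have "c \<in> carrier_vec (b i)" by (simp add: c_def)
  moreover have "strand i u c = y u" for u
  proof
    fix j
    show "strand i u c j = y u j"
    proof (cases "j < b i \<and> shift i j divides u")
      case True
      have "strand i u c j = (\<Sum>t\<in>?Z. Poly_Mapping.lookup (Poly_Mapping.single (t - shift i j) (y t j)) (u - shift i j))"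
        using True by (simp add: strand_def c_def lookup_sum)
      also have "\<dots> = (\<Sum>t\<in>?Z. if t = u then y u j else 0)"
      proof (intro sum.cong refl)
        fix t
        have "t = u" if "y t j \<noteq> 0" "t - shift i j = u - shift i j"
        proof -
          have "shift i j divides t" using y[of t] that(1) by (auto simp: supported_iff)
          then show ?thesis
            using that(2) True by (metis divides_add_diff)
        qed
        then show "Poly_Mapping.lookup (Poly_Mapping.single (t - shift i j) (y t j)) (u - shift i j) = (if t = u then y u j else 0)"
          by (auto simp: lookup_single when_def)
      qed
      also have "\<dots> = y u j"
        using fin by auto
      finally show ?thesis .
    next
      case False
      then show ?thesis using y[of u] by (auto simp: strand_def supported_iff)
    qed
  qed
  ultimately show ?thesis by blast
qed

text \<open>Exactness can be checked strand by strand: only finitely many strands of \<open>c\<close> are nonzero, and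
  chosen preimages of these are the strands of a single vector.\<close>
lemma lift_strandwise:
  assumes c: "c \<in> carrier_vec (b i)"
    and lift: "\<And>t. \<exists>y. supported (b (Suc i)) (\<mu> (Suc i)) (divisors m A t) y \<and>
      (\<forall>k<b i. strand i t c k = (\<Sum>j<b (Suc i). C i k j * y j))"
  shows "\<exists>c'\<in>carrier_vec (b (Suc i)). c = differential i *\<^sub>v c'"
proof -
  from lift obtain y0 where y0: "\<And>t. supported (b (Suc i)) (\<mu> (Suc i)) (divisors m A t) (y0 t)"
    "\<And>t k. k < b i \<Longrightarrow> strand i t c k = (\<Sum>j<b (Suc i). C i k j * y0 t j)"
    by metis
  define y where "y t = (if strand i t c = (\<lambda>_. 0) then (\<lambda>_. 0) else y0 t)" for t
  have "finite {t. y t \<noteq> (\<lambda>_. 0)}"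
    by (rule finite_subset[OF _ finite_strands[OF c]]) (auto simp: y_def)
  moreover have "supported (b (Suc i)) (\<mu> (Suc i)) (divisors m A t) (y t)" for t
    using y0(1)[of t] by (auto simp: y_def supported_def)
  ultimately obtain c' where c': "c' \<in> carrier_vec (b (Suc i))" "\<And>t. strand (Suc i) t c' = y t"
    using strands_assemble[of y "Suc i"] by blast
  have "c = differential i *\<^sub>v c'"
  proof (rule strand_eqI[OF c])
    show "differential i *\<^sub>v c' \<in> carrier_vec (b i)"
      using differential_carrier c'(1) by (rule mult_mat_vec_carrier)
    fix t j assume j: "j < b i"
    show "strand i t c j = strand i t (differential i *\<^sub>v c') j"
      unfolding strand_differential[OF c'(1) j] c'(2) using y0(2)[OF j, of t]
      by (auto simp: y_def)
  qed
  with c'(1) show ?thesis by blast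
qed

text \<open>The strand of multidegree \<open>t\<close> consists of the basis vectors with labels contained in the closed
  set \<open>divisors m A t\<close>, and there the frame is exact by assumption.\<close>
theorem minimal_resolution:
  "minimal_graded_free_resolution (monomial_ideal m A) b (\<lambda>i j. int (monom_degree (shift i j)))
    (vec 1 (\<lambda>_. 1)) differential"
proof
  show aug: "vec 1 (\<lambda>_. 1) \<in> carrier_vec (b 0)" by (simp add: rank_0)
  have aug_prod: "vec 1 (\<lambda>_. 1) \<bullet> c = c $ 0" if "c \<in> carrier_vec (b 0)" for c :: "('v, 'k) mpoly vec"
    using that by (simp add: scalar_prod_def rank_0)
  show "differential i \<in> carrier_mat (b i) (b (Suc i))" for i by (rule differential_carrier)
  show "homogeneous (int (monom_degree (shift 0 j))) (vec 1 (\<lambda>_. 1 :: ('v, 'k) mpoly) $ j)" if "j < b 0" for j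
    using that by (simp add: rank_0 shift_0 homogeneous_def)
  have entry: "differential i $$ (k, j) = Poly_Mapping.single (shift (Suc i) j - shift i k) (C i k j)"
    if "k < b i" "j < b (Suc i)" for i j k
    using that by (simp add: differential_def)
  show "homogeneous (int (monom_degree (shift (Suc i) j)) - int (monom_degree (shift i k))) (differential i $$ (k, j))"
    if "k < b i" "j < b (Suc i)" for i j k
  proof (cases "C i k j = 0")
    case False
    then show ?thesis
      using monom_degree_diff[OF shift_strict(1)[OF that False]] by (simp add: entry[OF that] homogeneous_def)
  qed (simp add: entry[OF that] homogeneous_def)
  show "differential i $$ (k, j) \<in> irrelevant_ideal" if "k < b i" "j < b (Suc i)" for i j k
  proof (cases "C i k j = 0")
    case False
    then show ?thesis
      unfolding entry[OF that] by (intro single_in_irrelevant_ideal shift_strict(2)[OF that])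
  qed (simp add: entry[OF that] irrelevant_ideal_def polynomial_ring.span_zero)
  show "\<exists>c\<in>carrier_vec (b 0). f - vec 1 (\<lambda>_. 1) \<bullet> c \<in> monomial_ideal m A" for f :: "('v, 'k) mpoly"
  proof (intro bexI[of _ "vec (b 0) (\<lambda>_. f)"])
    have "vec 1 (\<lambda>_. 1) \<bullet> vec (b 0) (\<lambda>_. f) = f"
      using aug_prod[of "vec (b 0) (\<lambda>_. f)"] by (simp add: rank_0)
    then show "f - vec 1 (\<lambda>_. 1) \<bullet> vec (b 0) (\<lambda>_. f) \<in> monomial_ideal m A"
      by (simp add: monomial_ideal_iff)
  qed simp
  have strand_0: "strand 0 t c 0 = Poly_Mapping.lookup (c $ 0) t" for t c
    by (simp add: strand_def rank_0 shift_0)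
  show "{differential 0 *\<^sub>v c |c. c \<in> carrier_vec (b 1)} =
    {c \<in> carrier_vec (b 0). vec 1 (\<lambda>_. 1) \<bullet> c \<in> monomial_ideal m A}"
  proof (intro subset_antisym subsetI)
    fix e :: "('v, 'k) mpoly vec" assume "e \<in> {differential 0 *\<^sub>v c |c. c \<in> carrier_vec (b 1)}"
    then obtain c where c: "c \<in> carrier_vec (b (Suc 0))" and e: "e = differential 0 *\<^sub>v c" by auto
    have e_c: "e \<in> carrier_vec (b 0)"
      unfolding e using differential_carrier c by (rule mult_mat_vec_carrier)
    have "\<exists>k\<in>A. m k divides t" if "Poly_Mapping.lookup (e $ 0) t \<noteq> 0" for t
    proof -
      have "(\<Sum>j<b (Suc 0). C 0 0 j * strand (Suc 0) t c j) \<noteq> 0"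
        using that strand_differential[OF c, of 0 t] by (simp add: e strand_0[symmetric] rank_0)
      then obtain j where j: "j < b (Suc 0)" "C 0 0 j \<noteq> 0" "strand (Suc 0) t c j \<noteq> 0"
        by (metis (no_types, lifting) lessThan_iff mult_eq_0_iff sum.neutral)
      have "\<mu> (Suc 0) j \<subseteq> divisors m A t"
        using strand_supported[of "Suc 0" t c] j(3) by (auto simp: supported_def)
      moreover have "\<mu> (Suc 0) j \<noteq> {}"
        using strict[of 0 0 j] j rank_0 by auto
      ultimately show ?thesis by (auto simp: divisors_def)
    qed
    then show "e \<in> {c \<in> carrier_vec (b 0). vec 1 (\<lambda>_. 1) \<bullet> c \<in> monomial_ideal m A}"
      using e_c by (simp add: aug_prod monomial_ideal_iff del: One_nat_def)
  next
    fix e :: "('v, 'k) mpoly vec" assume "e \<in> {c \<in> carrier_vec (b 0). vec 1 (\<lambda>_. 1) \<bullet> c \<in> monomial_ideal m A}"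
    then have e_c: "e \<in> carrier_vec (b 0)" and "vec 1 (\<lambda>_. 1) \<bullet> e \<in> monomial_ideal m A" by simp_all
    then have e: "e \<in> carrier_vec (b 0)" "e $ 0 \<in> monomial_ideal m A"
      unfolding aug_prod[OF e_c] by simp_all
    have "\<exists>c\<in>carrier_vec (b (Suc 0)). e = differential 0 *\<^sub>v c"
    proof (rule lift_strandwise[OF e(1)])
      fix t
      show "\<exists>y. supported (b (Suc 0)) (\<mu> (Suc 0)) (divisors m A t) y \<and>
        (\<forall>k<b 0. strand 0 t e k = (\<Sum>j<b (Suc 0). C 0 k j * y j))"
      proof (cases "Poly_Mapping.lookup (e $ 0) t = 0")
        case True
        then show ?thesis
          by (intro exI[of _ "\<lambda>_. 0"]) (simp add: supported_def rank_0 strand_0)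
      next
        case False
        then have "divisors m A t \<noteq> {}"
          using e(2) by (auto simp: monomial_ideal_iff divisors_def)
        from augmented[OF divisors_closed[OF finite_A] this]
        obtain y where y: "supported (b 1) (\<mu> 1) (divisors m A t) y" "(\<Sum>j<b 1. C 0 0 j * y j) = 1" by auto
        have "(\<Sum>j<b 1. C 0 0 j * (Poly_Mapping.lookup (e $ 0) t * y j)) =
          Poly_Mapping.lookup (e $ 0) t * (\<Sum>j<b 1. C 0 0 j * y j)"
          unfolding sum_distrib_left by (intro sum.cong refl mult.left_commute)
        with y show ?thesis
          by (intro exI[of _ "\<lambda>j. Poly_Mapping.lookup (e $ 0) t * y j"])
            (auto simp: supported_def rank_0 strand_0)
      qed
    qed
    then show "e \<in> {differential 0 *\<^sub>v c |c. c \<in> carrier_vec (b 1)}" by auto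
  qed
  show "{differential (Suc i) *\<^sub>v c |c. c \<in> carrier_vec (b (Suc (Suc i)))} = mat_kernel (differential i)" for i
  proof (intro subset_antisym subsetI)
    fix e :: "('v, 'k) mpoly vec" assume "e \<in> {differential (Suc i) *\<^sub>v c |c. c \<in> carrier_vec (b (Suc (Suc i)))}"
    then obtain c where c: "c \<in> carrier_vec (b (Suc (Suc i)))" and e: "e = differential (Suc i) *\<^sub>v c" by auto
    have e_c: "e \<in> carrier_vec (b (Suc i))"
      unfolding e using differential_carrier c by (rule mult_mat_vec_carrier)
    have "differential i *\<^sub>v e = 0\<^sub>v (b i)"
    proof (rule strand_eqI)
      show "differential i *\<^sub>v e \<in> carrier_vec (b i)"
        using differential_carrier e_c by (rule mult_mat_vec_carrier)
      fix t k assume k: "k < b i"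
      have "strand i t (differential i *\<^sub>v e) k =
        (\<Sum>j<b (Suc i). \<Sum>l<b (Suc (Suc i)). C i k j * (C (Suc i) j l * strand (Suc (Suc i)) t c l))"
        unfolding strand_differential[OF e_c k] sum_distrib_left[symmetric]
        by (intro sum.cong refl) (simp add: e strand_differential[OF c])
      also have "\<dots> = (\<Sum>l<b (Suc (Suc i)). \<Sum>j<b (Suc i). C i k j * (C (Suc i) j l * strand (Suc (Suc i)) t c l))"
        by (rule sum.swap)
      also have "\<dots> = (\<Sum>l<b (Suc (Suc i)). (\<Sum>j<b (Suc i). C i k j * C (Suc i) j l) * strand (Suc (Suc i)) t c l)"
        by (simp only: sum_distrib_right mult.assoc)
      also have "\<dots> = 0"
        using complex[OF k] by simp
      finally show "strand i t (differential i *\<^sub>v e) k = strand i t (0\<^sub>v (b i)) k"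
        using k by (simp add: strand_def)
    qed simp
    then show "e \<in> mat_kernel (differential i)"
      using e_c by (simp add: mat_kernel_def differential_def)
  next
    fix e :: "('v, 'k) mpoly vec" assume "e \<in> mat_kernel (differential i)"
    then have e: "e \<in> carrier_vec (b (Suc i))" "differential i *\<^sub>v e = 0\<^sub>v (b i)"
      by (auto simp: mat_kernel_def differential_def)
    have "\<exists>c\<in>carrier_vec (b (Suc (Suc i))). e = differential (Suc i) *\<^sub>v c"
    proof (rule lift_strandwise[OF e(1)])
      fix t
      have "(\<Sum>j<b (Suc i). C i k j * strand (Suc i) t e j) = 0" if "k < b i" for k
      proof -
        have "strand i t (0\<^sub>v (b i)) k = 0"
          using that by (simp add: strand_def)
        then show ?thesis
          using strand_differential[OF e(1) that, of t] by (simp add: e(2))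
      qed
      from exact[OF divisors_closed[OF finite_A] strand_supported this]
      show "\<exists>y. supported (b (Suc (Suc i))) (\<mu> (Suc (Suc i))) (divisors m A t) y \<and>
        (\<forall>k<b (Suc i). strand (Suc i) t e k = (\<Sum>j<b (Suc (Suc i)). C (Suc i) k j * y j))" .
    qed
    then show "e \<in> {differential (Suc i) *\<^sub>v c |c. c \<in> carrier_vec (b (Suc (Suc i)))}" by auto
  qed
qed

end

lemma empty_closed:
  assumes "\<And>k. k \<in> A \<Longrightarrow> m k \<noteq> 0"
  shows "{} \<in> closed_sets m A"
  using assms by (auto simp: closed_sets_def)

text \<open>The theorem of Gasharov, Peeva and Welker: one and the same frame yields minimal resolutions of
  both ideals.\<close>
theorem betti_eq_of_closed_sets_eq:
  fixes m m' :: "'i \<Rightarrow> ('v::finite \<Rightarrow>\<^sub>0 nat)"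
  assumes fin: "finite A" and nz: "\<And>k. k \<in> A \<Longrightarrow> m k \<noteq> 0"
    and closed: "closed_sets m A = closed_sets m' A"
  shows "betti_quot (monomial_ideal m A :: ('v, 'k::field) mpoly set) r =
      betti_quot (monomial_ideal m' A :: ('v, 'k) mpoly set) r"
    and "(\<And>T. T \<in> closed_sets m A \<Longrightarrow> monom_degree (lcm_monom m T) = monom_degree (lcm_monom m' T)) \<Longrightarrow>
      graded_betti_quot (monomial_ideal m A :: ('v, 'k) mpoly set) r e =
      graded_betti_quot (monomial_ideal m' A :: ('v, 'k) mpoly set) r e"
proof -
  have "finite (closed_sets m A)"
    by (rule finite_subset[of _ "Pow A"]) (use fin in \<open>auto simp: closed_sets_def\<close>)
  then obtain b \<mu> and C :: "nat \<Rightarrow> nat \<Rightarrow> nat \<Rightarrow> 'k" where frame: "resolution_frame (closed_sets m A) b \<mu> C"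
    using resolution_frame_exists[OF _ empty_closed[of A m], OF _ nz] by blast
  interpret M: monomial_frame m A b \<mu> C
    using frame fin by (simp add: monomial_frame_def monomial_frame_axioms_def)
  interpret M': monomial_frame m' A b \<mu> C
    using frame fin by (simp add: monomial_frame_def monomial_frame_axioms_def closed)
  note res = M.minimal_resolution M'.minimal_resolution
  show "betti_quot (monomial_ideal m A :: ('v, 'k) mpoly set) r =
      betti_quot (monomial_ideal m' A :: ('v, 'k) mpoly set) r"
    by (simp add: betti_quot_eq[OF res(1) homogeneous_monomial_ideal]
        betti_quot_eq[OF res(2) homogeneous_monomial_ideal])
  assume deg: "\<And>T. T \<in> closed_sets m A \<Longrightarrow> monom_degree (lcm_monom m T) = monom_degree (lcm_monom m' T)"
  have "monom_degree (M.shift r j) = monom_degree (M'.shift r j)" if "j < b r" for j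
    unfolding M.shift_def M'.shift_def by (rule deg[OF M.label[OF that]])
  then show "graded_betti_quot (monomial_ideal m A :: ('v, 'k) mpoly set) r e =
      graded_betti_quot (monomial_ideal m' A :: ('v, 'k) mpoly set) r e"
    unfolding graded_betti_quot_eq[OF res(1) homogeneous_monomial_ideal]
      graded_betti_quot_eq[OF res(2) homogeneous_monomial_ideal]
    by (intro arg_cong[of _ _ card]) auto
qed

section \<open>Edge ideals and sinks\<close>

lemma monomial_ideal_cong: "m ` A = m' ` B \<Longrightarrow> monomial_ideal m A = monomial_ideal m' B"
proof -
  assume "m ` A = m' ` B"
  then have "(\<lambda>t. Poly_Mapping.single t 1) ` (m ` A) = (\<lambda>t. Poly_Mapping.single t 1) ` (m' ` B)"
    by (rule arg_cong)
  then show ?thesis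
    unfolding monomial_ideal_def image_image by (rule arg_cong)
qed

lemma divides_lcm_monom_iff:
  assumes "finite T"
  shows "s divides lcm_monom m T \<longleftrightarrow>
    (\<forall>v. Poly_Mapping.lookup s v = 0 \<or> (\<exists>l\<in>T. Poly_Mapping.lookup s v \<le> Poly_Mapping.lookup (m l) v))"
proof -
  have "a \<le> Max (insert 0 ((\<lambda>k. Poly_Mapping.lookup (m k) v) ` T)) \<longleftrightarrow>
    a = 0 \<or> (\<exists>l\<in>T. a \<le> Poly_Mapping.lookup (m l) v)" for a v
    by (subst Max_ge_iff) (use assms in auto)
  then show ?thesis
    unfolding divides_def lookup_lcm_monom by blast
qed

text \<open>Scaling all exponents of a variable by the same positive factor does not affect comparisons
  between them.\<close>
lemma closed_sets_scale:
  assumes fin: "finite A"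
    and scale: "\<And>k v. k \<in> A \<Longrightarrow> Poly_Mapping.lookup (m k) v = \<phi> v * Poly_Mapping.lookup (m' k) v"
    and pos: "\<And>v. \<phi> v > 0"
  shows "closed_sets m A = closed_sets m' A"
proof -
  have "m k divides lcm_monom m T \<longleftrightarrow> m' k divides lcm_monom m' T" if "T \<subseteq> A" "k \<in> A" for T k
  proof -
    have "(Poly_Mapping.lookup (m k) v = 0 \<or> (\<exists>l\<in>T. Poly_Mapping.lookup (m k) v \<le> Poly_Mapping.lookup (m l) v)) \<longleftrightarrow>
      (Poly_Mapping.lookup (m' k) v = 0 \<or> (\<exists>l\<in>T. Poly_Mapping.lookup (m' k) v \<le> Poly_Mapping.lookup (m' l) v))" for v
      using that pos[of v] scale by (auto simp: subset_iff)
    then show ?thesis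
      using finite_subset[OF that(1) fin] by (simp add: divides_lcm_monom_iff)
  qed
  then show ?thesis
    unfolding closed_sets_def by blast
qed

definition edge_monom :: "'v wograph \<Rightarrow> 'v \<times> 'v \<Rightarrow> ('v \<Rightarrow>\<^sub>0 nat)" where
  "edge_monom D e = Poly_Mapping.single (fst e) 1 + Poly_Mapping.single (snd e) (weight D (snd e))"

lemma var_power: "(var v :: ('v, 'k::comm_ring_1) mpoly) ^ k = Poly_Mapping.single (Poly_Mapping.single v k) 1"
proof (induction k)
  case 0
  show ?case by (simp only: power_0 single_zero single_one)
next
  case (Suc k)
  have "Poly_Mapping.single v 1 + Poly_Mapping.single v k = Poly_Mapping.single v (Suc k)"
    by (simp add: single_add[symmetric])
  then show ?case
    unfolding power_Suc Suc by (simp add: var_def mult_single)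
qed

lemma edge_ideal_monomial: "edge_ideal D = monomial_ideal (edge_monom D) (edges D)"
proof -
  have "var x * var y ^ weight D y = (Poly_Mapping.single (edge_monom D (x, y)) 1 :: ('a, 'b) mpoly)" for x y
    unfolding var_power by (simp add: var_def edge_monom_def mult_single)
  then show ?thesis
    unfolding edge_ideal_def monomial_ideal_def
    by (intro arg_cong[of _ _ polynomial_ring.span]) (force simp: image_iff)
qed

lemma edge_monom_nonzero: "edge_monom D e \<noteq> 0"
proof
  assume "edge_monom D e = 0"
  then have "Poly_Mapping.lookup (edge_monom D e) (fst e) = 0" by simp
  then show False by (simp add: edge_monom_def lookup_add)
qed

text \<open>No edge starts at a sink \<open>v\<close>, so \<open>v\<close> has the exponent 0 or \<open>weight D v\<close> in each generator.
  Changing the weight of \<open>v\<close> to 1 therefore only rescales exponents.\<close>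
theorem betti_quot_sink_graph:
  fixes D :: "'v::finite wograph"
  assumes "weighted_oriented_graph D"
  shows "betti_quot (edge_ideal D :: ('v, 'k::field) mpoly set) r =
    betti_quot (edge_ideal (sink_graph D) :: ('v, 'k) mpoly set) r"
proof -
  have "closed_sets (edge_monom D) (edges D) = closed_sets (edge_monom (sink_graph D)) (edges D)"
  proof (rule closed_sets_scale[where \<phi> = "\<lambda>v. if is_sink D v then weight D v else 1"])
    fix e v assume e: "e \<in> edges D"
    then have "fst e \<noteq> snd e" using assms by (auto simp: weighted_oriented_graph_def)
    moreover from this have "\<not> is_sink D (fst e)"
      using e unfolding is_sink_def by (cases e) fastforce
    ultimately show "Poly_Mapping.lookup (edge_monom D e) v =
      (if is_sink D v then weight D v else 1) * Poly_Mapping.lookup (edge_monom (sink_graph D) e) v"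
      by (auto simp: edge_monom_def sink_graph_def lookup_add lookup_single when_def)
  next
    show "0 < (if is_sink D v then weight D v else 1)" for v
      using assms by (auto simp: weighted_oriented_graph_def Suc_le_eq)
  qed simp
  from betti_eq_of_closed_sets_eq(1)[OF finite edge_monom_nonzero this]
  show ?thesis
    by (simp add: edge_ideal_monomial sink_graph_def)
qed

section \<open>Straightening a path\<close>

definition path_monom :: "(nat \<Rightarrow> 'v) \<Rightarrow> (nat \<Rightarrow> nat) \<Rightarrow> (nat \<Rightarrow> nat) \<Rightarrow> nat \<Rightarrow> ('v \<Rightarrow>\<^sub>0 nat)" where
  "path_monom x l r i = Poly_Mapping.single (x i) (l i) + Poly_Mapping.single (x (i + 1)) (r i)"

locale path_vertices =
  fixes n :: nat and x :: "nat \<Rightarrow> 'v::finite"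
  assumes bij: "bij_betw x {1..n+1} UNIV"
begin

lemma vertex_eq_iff: "i \<in> {1..n+1} \<Longrightarrow> j \<in> {1..n+1} \<Longrightarrow> x i = x j \<longleftrightarrow> i = j"
  using bij inj_on_eq_iff[of x "{1..n+1}" i j] unfolding bij_betw_def by blast

lemma vertex_cases: obtains j where "j \<in> {1..n+1}" "v = x j"
proof -
  have "v \<in> x ` {1..n+1}" using bij by (simp only: bij_betw_def UNIV_I)
  then show thesis using that by blast
qed

lemma all_vertices: "(\<forall>v. Q v) \<longleftrightarrow> (\<forall>j\<in>{1..n+1}. Q (x j))"
proof -
  have "Q v" if "\<forall>j\<in>{1..n+1}. Q (x j)" for v
    using that by (rule_tac vertex_cases[of v]) auto
  then show ?thesis by blast
qed

lemma lookup_path_monom: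
  assumes "i \<in> {1..n}" "j \<in> {1..n+1}"
  shows "Poly_Mapping.lookup (path_monom x l r i) (x j) =
    (if i = j then l i else if i + 1 = j then r i else 0)"
proof -
  have "x i = x j \<longleftrightarrow> i = j" "x (i + 1) = x j \<longleftrightarrow> i + 1 = j"
    using assms by (auto intro!: vertex_eq_iff)
  then show ?thesis
    unfolding path_monom_def lookup_add lookup_single when_def by simp
qed

text \<open>The two vertices of the edge \<open>k\<close> only occur in the generators \<open>k - 1\<close>, \<open>k\<close> and \<open>k + 1\<close>, so both
  neighbours must lie in \<open>T\<close> and provide the exponents. At the ends of the path, \<open>k - 1 = 0\<close> and
  \<open>k + 1 = n + 1\<close> are not in \<open>T\<close>, and both sides are false.\<close>
lemma path_monom_divides_lcm_iff:
  assumes T: "T \<subseteq> {1..n}" and k: "k \<in> {1..n}" "k \<notin> T"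
    and pos: "l k > 0" "r k > 0"
  shows "path_monom x l r k divides lcm_monom (path_monom x l r) T \<longleftrightarrow>
    (k - 1 \<in> T \<and> l k \<le> r (k - 1)) \<and> (k + 1 \<in> T \<and> r k \<le> l (k + 1))"
proof -
  let ?m = "path_monom x l r"
  let ?Q = "\<lambda>j. Poly_Mapping.lookup (?m k) (x j) = 0 \<or>
    (\<exists>i\<in>T. Poly_Mapping.lookup (?m k) (x j) \<le> Poly_Mapping.lookup (?m i) (x j))"
  have fin: "finite T" using T by (rule finite_subset) simp
  have lT: "Poly_Mapping.lookup (?m i) (x j) = (if i = j then l i else if i + 1 = j then r i else 0)"
    if "i \<in> T" "j \<in> {1..n+1}" for i j
    using T that by (intro lookup_path_monom) auto
  have "?m k divides lcm_monom ?m T \<longleftrightarrow> (\<forall>j\<in>{1..n+1}. ?Q j)"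
    unfolding divides_lcm_monom_iff[OF fin] by (rule all_vertices)
  also have "\<dots> \<longleftrightarrow> ?Q k \<and> ?Q (k + 1)"
    using k(1) by (auto simp: lookup_path_monom)
  also have "?Q k \<longleftrightarrow> k - 1 \<in> T \<and> l k \<le> r (k - 1)"
  proof -
    have "?Q k \<longleftrightarrow> (\<exists>i\<in>T. l k \<le> Poly_Mapping.lookup (?m i) (x k))"
      using k(1) pos by (simp add: lookup_path_monom)
    also have "\<dots> \<longleftrightarrow> (\<exists>i\<in>T. i + 1 = k \<and> l k \<le> r i)"
      using k pos by (intro bex_cong refl) (auto simp: lT)
    also have "\<dots> \<longleftrightarrow> k - 1 \<in> T \<and> l k \<le> r (k - 1)"
      using k(1) by (auto intro!: bexI[of _ "k - 1"])
    finally show ?thesis .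
  qed
  also have "?Q (k + 1) \<longleftrightarrow> k + 1 \<in> T \<and> r k \<le> l (k + 1)"
  proof -
    have "?Q (k + 1) \<longleftrightarrow> (\<exists>i\<in>T. r k \<le> Poly_Mapping.lookup (?m i) (x (k + 1)))"
      using k(1) pos by (simp add: lookup_path_monom)
    also have "\<dots> \<longleftrightarrow> (\<exists>i\<in>T. i = k + 1 \<and> r k \<le> l i)"
      using k pos by (intro bex_cong refl) (auto simp: lT)
    also have "\<dots> \<longleftrightarrow> k + 1 \<in> T \<and> r k \<le> l (k + 1)"
      by auto
    finally show ?thesis .
  qed
  finally show ?thesis .
qed

lemma lookup_lcm_path_monom:
  assumes T: "T \<subseteq> {1..n}" and j: "j \<in> {1..n+1}"
  shows "Poly_Mapping.lookup (lcm_monom (path_monom x l r) T) (x j) =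
    max (if j \<in> T then l j else 0) (if j - 1 \<in> T then r (j - 1) else 0)"
proof -
  have fin: "finite T" using T by (rule finite_subset) simp
  have "Poly_Mapping.lookup (lcm_monom (path_monom x l r) T) (x j) \<le> N \<longleftrightarrow>
    max (if j \<in> T then l j else 0) (if j - 1 \<in> T then r (j - 1) else 0) \<le> N" for N
  proof -
    have "Poly_Mapping.lookup (lcm_monom (path_monom x l r) T) (x j) \<le> N \<longleftrightarrow>
      (\<forall>i\<in>T. Poly_Mapping.lookup (path_monom x l r i) (x j) \<le> N)"
      unfolding lookup_lcm_monom by (subst Max_le_iff) (use fin in auto)
    also have "\<dots> \<longleftrightarrow> (\<forall>i\<in>T. (i = j \<longrightarrow> l i \<le> N) \<and> (i + 1 = j \<longrightarrow> r i \<le> N))"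
    proof (intro ball_cong refl)
      fix i assume "i \<in> T"
      then have "i \<in> {1..n}" using T by blast
      then show "(Poly_Mapping.lookup (path_monom x l r i) (x j) \<le> N) =
        ((i = j \<longrightarrow> l i \<le> N) \<and> (i + 1 = j \<longrightarrow> r i \<le> N))"
        using lookup_path_monom[OF _ j, of i l r] by auto
    qed
    also have "\<dots> \<longleftrightarrow> (j \<in> T \<longrightarrow> l j \<le> N) \<and> (j - 1 \<in> T \<longrightarrow> r (j - 1) \<le> N)"
    proof -
      have "j = (j - 1) + 1" using j by auto
      then show ?thesis by (metis add_right_cancel)
    qed
    finally show ?thesis by auto
  qed
  then show ?thesis by (meson order.antisym order.refl)
qed

lemma monom_degree_vertices: "monom_degree t = (\<Sum>j=1..n+1. Poly_Mapping.lookup t (x j))"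
  unfolding monom_degree_sum by (rule sum.reindex_bij_betw[OF bij, symmetric])

text \<open>
  Here \<open>e i\<close> is the weight of the head of the edge \<open>i\<close>, which is its right end if \<open>fwd i\<close> and its left
  end otherwise. The assumption \<open>turn\<close> says that weights are 1 where two heads meet. If \<open>k \<notin> T\<close> and both
  neighbours of \<open>k\<close> lie in \<open>T\<close>, whether the generator \<open>k\<close> divides the least common multiple over \<open>T\<close>
  is decided as follows. At its tail, the edge \<open>k\<close> has the exponent 1, which imposes no condition. At
  its head, it has the exponent \<open>e k\<close>, and the neighbour contributes 1 there: either it has its tail at this
  vertex, or two heads meet and the weight is 1. So the condition is \<open>e k = 1\<close>, independently of the
  directions.
\<close>
theorem betti_straightened_path:
  fixes e :: "nat \<Rightarrow> nat" and fwd :: "nat \<Rightarrow> bool"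
  assumes pos: "\<And>i. i \<in> {1..n} \<Longrightarrow> e i > 0"
    and turn: "\<And>i. i \<in> {1..n} \<Longrightarrow> i + 1 \<in> {1..n} \<Longrightarrow> fwd i \<Longrightarrow> \<not> fwd (i + 1) \<Longrightarrow> e i = 1 \<and> e (i + 1) = 1"
  defines "m \<equiv> path_monom x (\<lambda>i. if fwd i then 1 else e i) (\<lambda>i. if fwd i then e i else 1)"
    and "m' \<equiv> path_monom x (\<lambda>_. 1) e"
  shows "betti_quot (monomial_ideal m {1..n} :: ('v, 'k::field) mpoly set) r =
      betti_quot (monomial_ideal m' {1..n} :: ('v, 'k) mpoly set) r"
    and "graded_betti_quot (monomial_ideal m {1..n} :: ('v, 'k) mpoly set) r d =
      graded_betti_quot (monomial_ideal m' {1..n} :: ('v, 'k) mpoly set) r d"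
proof -
  let ?l = "\<lambda>i. if fwd i then 1 else e i" and ?r = "\<lambda>i. if fwd i then e i else 1"
  have dvd: "m k divides lcm_monom m T \<longleftrightarrow> m' k divides lcm_monom m' T"
    if T: "T \<subseteq> {1..n}" and k: "k \<in> {1..n}" "k \<notin> T" for T k
  proof -
    have "m k divides lcm_monom m T \<longleftrightarrow>
      (k - 1 \<in> T \<and> ?l k \<le> ?r (k - 1)) \<and> (k + 1 \<in> T \<and> ?r k \<le> ?l (k + 1))"
      unfolding m_def by (rule path_monom_divides_lcm_iff[OF T k]) (use pos[OF k(1)] in auto)
    also have "\<dots> \<longleftrightarrow> (k - 1 \<in> T \<and> 1 \<le> e (k - 1)) \<and> (k + 1 \<in> T \<and> e k \<le> 1)"
    proof (cases "k - 1 \<in> T \<and> k + 1 \<in> T")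
      case True
      then have *: "k - 1 \<in> {1..n}" "k + 1 \<in> {1..n}" "k - 1 + 1 = k" using T k by auto
      show ?thesis
        using pos[OF *(1)] pos[OF k(1)] pos[OF *(2)] turn[OF *(1)] turn[OF k(1) *(2)] k(1) True
        unfolding *(3) by auto
    qed auto
    also have "\<dots> \<longleftrightarrow> m' k divides lcm_monom m' T"
      unfolding m'_def by (rule path_monom_divides_lcm_iff[OF T k, symmetric]) (use pos[OF k(1)] in auto)
    finally show ?thesis .
  qed
  have closed: "closed_sets m {1..n} = closed_sets m' {1..n}"
    unfolding closed_sets_def using dvd by blast
  have nz: "m k \<noteq> 0" if "k \<in> {1..n}" for k
  proof
    assume "m k = 0"
    then have "Poly_Mapping.lookup (m k) (x k) = 0" by simp
    then show False
      using that pos[OF that] lookup_path_monom[OF that, of k ?l ?r] by (auto simp: m_def split: if_splits)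
  qed
  have deg: "monom_degree (lcm_monom m T) = monom_degree (lcm_monom m' T)" if "T \<in> closed_sets m {1..n}" for T
  proof -
    have T: "T \<subseteq> {1..n}" using that by (simp add: closed_sets_def)
    \<comment> \<open>Reversing a backward edge \<open>i \<in> T\<close> moves \<open>e i - 1\<close> units of the exponent from its left end to
      its right end. These transfers cancel in the degree, which is the sum over all vertices.\<close>
    define f where "f i = (if i \<in> T \<and> \<not> fwd i then e i - 1 else 0)" for i
    define h where "h j = Poly_Mapping.lookup (lcm_monom m T) (x j)" for j
    define h' where "h' j = Poly_Mapping.lookup (lcm_monom m' T) (x j)" for j
    have step: "h j + f (j - 1) = h' j + f j" if j: "j \<in> {1..n+1}" for j
    proof -
      have pT: "e i > 0" if "i \<in> T" for i using pos T that by auto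
      have tT: "e (j - 1) = 1 \<and> e j = 1" if "j - 1 \<in> T" "j \<in> T" "fwd (j - 1)" "\<not> fwd j"
      proof -
        have "j - 1 \<in> {1..n}" "j \<in> {1..n}" "j - 1 + 1 = j" using that T j by auto
        then show ?thesis using turn[of "j - 1"] that by simp
      qed
      show ?thesis
        unfolding h_def h'_def m_def m'_def lookup_lcm_path_monom[OF T j] f_def
        using pT[of j] pT[of "j - 1"] tT by auto
    qed
    have f0: "f 0 = 0" "f (n + 1) = 0" using T by (auto simp: f_def)
    have "(\<Sum>j=1..n+1. f (j - 1)) = (\<Sum>j=0..n. f j)"
      using sum.shift_bounds_cl_Suc_ivl[of "\<lambda>j. f (j - 1)" 0 n] by simp
    also have "\<dots> = (\<Sum>j=1..n+1. f j)"
      using f0 by (simp add: sum.atLeast_Suc_atMost[of 0 n])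
    finally have shift: "(\<Sum>j=1..n+1. f (j - 1)) = (\<Sum>j=1..n+1. f j)" .
    have "(\<Sum>j=1..n+1. h j + f (j - 1)) = (\<Sum>j=1..n+1. h' j + f j)"
      by (intro sum.cong refl step)
    then have "(\<Sum>j=1..n+1. h j) = (\<Sum>j=1..n+1. h' j)"
      unfolding sum.distrib shift by simp
    then show ?thesis
      unfolding monom_degree_vertices h_def h'_def .
  qed
  show "betti_quot (monomial_ideal m {1..n} :: ('v, 'k) mpoly set) r =
      betti_quot (monomial_ideal m' {1..n} :: ('v, 'k) mpoly set) r"
    by (rule betti_eq_of_closed_sets_eq(1)[OF _ nz closed]) simp_all
  show "graded_betti_quot (monomial_ideal m {1..n} :: ('v, 'k) mpoly set) r d =
      graded_betti_quot (monomial_ideal m' {1..n} :: ('v, 'k) mpoly set) r d"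
    by (rule betti_eq_of_closed_sets_eq(2)[OF _ nz closed deg]) simp_all
qed

end

text \<open>The translation of the definitions: \<open>fwd i\<close> holds if the \<open>i\<close>-th edge points forward, and where two
  heads meet the vertex is a sink, to which \<open>sink_graph\<close> gives the weight 1.\<close>
lemma path_edge_ideals:
  fixes P :: "'v::finite wograph"
  assumes P: "weighted_oriented_path n x P"
  obtains fwd e where "(edge_ideal (sink_graph P) :: ('v, 'k::field) mpoly set) =
      monomial_ideal (path_monom x (\<lambda>i. if fwd i then 1 else e i) (\<lambda>i. if fwd i then e i else 1)) {1..n}"
    and "(edge_ideal (iron_graph n x P) :: ('v, 'k) mpoly set) = monomial_ideal (path_monom x (\<lambda>_. 1) e) {1..n}"
    and "\<And>i. i \<in> {1..n} \<Longrightarrow> e i > 0"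
    and "\<And>i. i \<in> {1..n} \<Longrightarrow> i + 1 \<in> {1..n} \<Longrightarrow> fwd i \<Longrightarrow> \<not> fwd (i + 1) \<Longrightarrow> e i = 1 \<and> e (i + 1) = 1"
proof
  define fwd where "fwd i \<longleftrightarrow> (x i, x (i + 1)) \<in> edges P" for i
  define e where "e i = weight (sink_graph P) (if fwd i then x (i + 1) else x i)" for i
  interpret path_vertices n x
    using P by unfold_locales (simp add: weighted_oriented_path_def)
  have adj: "(x i, x j) \<in> edges P \<or> (x j, x i) \<in> edges P \<longleftrightarrow> j = i + 1 \<or> i = j + 1"
    if "i \<in> {1..n+1}" "j \<in> {1..n+1}" for i j
    using P that by (simp add: weighted_oriented_path_def)
  have oriented: "(v, u) \<notin> edges P" if "(u, v) \<in> edges P" for u v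
    using P that by (auto simp: weighted_oriented_path_def weighted_oriented_graph_def)
  have bwd: "(x (i + 1), x i) \<in> edges P \<longleftrightarrow> \<not> fwd i" if "i \<in> {1..n}" for i
    using adj[of i "i + 1"] oriented that by (auto simp: fwd_def)
  have sink_edges: "edges (sink_graph P) = edges P" by (simp add: sink_graph_def)
  have edges: "edges P = (\<lambda>i. if fwd i then (x i, x (i + 1)) else (x (i + 1), x i)) ` {1..n}" (is "_ = ?E")
  proof
    show "?E \<subseteq> edges P" using bwd by (auto simp: fwd_def)
    show "edges P \<subseteq> ?E"
    proof
      fix p assume p: "p \<in> edges P"
      obtain u v where uv: "p = (u, v)" by fastforce
      obtain i where i: "i \<in> {1..n+1}" "u = x i" by (rule vertex_cases)
      obtain j where j: "j \<in> {1..n+1}" "v = x j" by (rule vertex_cases)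
      from adj[OF i(1) j(1)] p have "j = i + 1 \<or> i = j + 1" by (auto simp: uv i j)
      then show "p \<in> ?E"
      proof
        assume "j = i + 1"
        then show ?thesis
          using p i j by (auto simp: uv fwd_def intro!: image_eqI[of _ _ i])
      next
        assume *: "i = j + 1"
        then have "\<not> fwd j" using p oriented[of u v] by (auto simp: uv i j fwd_def)
        then show ?thesis
          using * i j by (auto simp: uv intro!: image_eqI[of _ _ j])
      qed
    qed
  qed
  have "edge_monom (sink_graph P) ` edges P =
    path_monom x (\<lambda>i. if fwd i then 1 else e i) (\<lambda>i. if fwd i then e i else 1) ` {1..n}"
    unfolding edges image_image
    by (rule image_cong) (auto simp: edge_monom_def path_monom_def e_def add.commute)
  then show "(edge_ideal (sink_graph P) :: ('v, 'k) mpoly set) =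
      monomial_ideal (path_monom x (\<lambda>i. if fwd i then 1 else e i) (\<lambda>i. if fwd i then e i else 1)) {1..n}"
    unfolding edge_ideal_monomial sink_edges by (rule monomial_ideal_cong)
  have iron_weight: "weight (iron_graph n x P) (x (i + 1)) = e i" if "i \<in> {1..n}" for i
  proof -
    have "the_inv_into {1..n+1} x (x (i + 1)) = i + 1"
      using bij that by (intro the_inv_into_f_f) (auto simp: bij_betw_def)
    then show ?thesis
      using that bwd[OF that] by (simp add: iron_graph_def Let_def sink_edges e_def)
  qed
  have "edges (iron_graph n x P) = (\<lambda>i. (x i, x (i + 1))) ` {1..n}"
    by (auto simp: iron_graph_def)
  then have "edge_monom (iron_graph n x P) ` edges (iron_graph n x P) = path_monom x (\<lambda>_. 1) e ` {1..n}"
    unfolding image_image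
    by (simp add: image_image, intro image_cong refl) (auto simp: edge_monom_def path_monom_def iron_weight[simplified])
  then show "(edge_ideal (iron_graph n x P) :: ('v, 'k) mpoly set) = monomial_ideal (path_monom x (\<lambda>_. 1) e) {1..n}"
    unfolding edge_ideal_monomial by (rule monomial_ideal_cong)
  have "weight P v \<ge> 1" for v
    using P by (auto simp: weighted_oriented_path_def weighted_oriented_graph_def)
  then show "e i > 0" for i
    by (auto simp: e_def sink_graph_def Suc_le_eq)
  fix i assume i: "i \<in> {1..n}" "i + 1 \<in> {1..n}" and turn: "fwd i" "\<not> fwd (i + 1)"
  have "(x (i + 1), w) \<notin> edges P" for w
  proof
    assume w: "(x (i + 1), w) \<in> edges P"
    obtain j where j: "j \<in> {1..n+1}" "w = x j" by (rule vertex_cases)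
    have "j = i \<or> j = i + 2"
      using adj[of "i + 1" j] w i j by auto
    then show False
      using w turn oriented by (auto simp: j fwd_def)
  qed
  then have "is_sink P (x (i + 1))"
    unfolding is_sink_def by blast
  then show "e i = 1 \<and> e (i + 1) = 1"
    using turn by (simp add: e_def sink_graph_def)
qed

theorem theorem4p14:
  fixes P :: "'v::finite wograph" and n :: nat and x :: "nat \<Rightarrow> 'v"
  assumes "weighted_oriented_path n x P"
  shows "(\<forall>r d. graded_betti_quot (edge_ideal (sink_graph P) :: ('v, 'k::field) mpoly set) r d =
                graded_betti_quot (edge_ideal (iron_graph n x P) :: ('v, 'k) mpoly set) r d) \<and>
         (\<forall>r. betti_quot (edge_ideal P :: ('v, 'k) mpoly set) r =
                betti_quot (edge_ideal (sink_graph P) :: ('v, 'k) mpoly set) r \<and>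
              betti_quot (edge_ideal (sink_graph P) :: ('v, 'k) mpoly set) r =
                betti_quot (edge_ideal (iron_graph n x P) :: ('v, 'k) mpoly set) r)"
proof -
  interpret path_vertices n x
    using assms by unfold_locales (simp add: weighted_oriented_path_def)
  have D: "weighted_oriented_graph P"
    using assms by (simp add: weighted_oriented_path_def)
  show ?thesis
  proof (rule path_edge_ideals[OF assms, where ?'k = 'k])
    fix fwd :: "nat \<Rightarrow> bool" and e :: "nat \<Rightarrow> nat"
    assume sink: "(edge_ideal (sink_graph P) :: ('v, 'k) mpoly set) =
        monomial_ideal (path_monom x (\<lambda>i. if fwd i then 1 else e i) (\<lambda>i. if fwd i then e i else 1)) {1..n}"
      and iron: "(edge_ideal (iron_graph n x P) :: ('v, 'k) mpoly set) =
        monomial_ideal (path_monom x (\<lambda>_. 1) e) {1..n}"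
      and pos: "\<And>i. i \<in> {1..n} \<Longrightarrow> e i > 0"
      and turn: "\<And>i. i \<in> {1..n} \<Longrightarrow> i + 1 \<in> {1..n} \<Longrightarrow> fwd i \<Longrightarrow> \<not> fwd (i + 1) \<Longrightarrow> e i = 1 \<and> e (i + 1) = 1"
    note straighten = betti_straightened_path[where fwd = fwd and e = e and ?'k = 'k, OF pos turn]
    show ?thesis
    proof (intro conjI allI)
      show "graded_betti_quot (edge_ideal (sink_graph P) :: ('v, 'k) mpoly set) r d =
          graded_betti_quot (edge_ideal (iron_graph n x P) :: ('v, 'k) mpoly set) r d" for r d
        unfolding sink iron by (rule straighten(2))
      show "betti_quot (edge_ideal P :: ('v, 'k) mpoly set) r =
          betti_quot (edge_ideal (sink_graph P) :: ('v, 'k) mpoly set) r" for r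
        by (rule betti_quot_sink_graph[OF D])
      show "betti_quot (edge_ideal (sink_graph P) :: ('v, 'k) mpoly set) r =
          betti_quot (edge_ideal (iron_graph n x P) :: ('v, 'k) mpoly set) r" for r
        unfolding sink iron by (rule straighten(1))
    qed
  qed
qed

end
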